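(* Let $F:\mathbb{R}^n\to\mathbb{R}^n$ be a single-valued continuously differentiable map and suppose the system $\dot x=F(x)$ is backward complete. Let $X_o,X_u\subset\mathbb{R}^n$ with $X_o$ closed and $X_o\cap X_u=\emptyset$. Then the system is safe with respect to $(X_o,X_u)$ if and only if there exists a continuous time-varying barrier function candidate $B:\mathbb{R}_{\geq0}\times\mathbb{R}^n\to\mathbb{R}$ for safety with respect to $(X_o,X_u)$ which is of class $\mathcal{C}^1$ on $(\mathbb{R}_{\geq0}\times\mathbb{R}^n)\setminus K$, where $K:=\{(t,x)\in\mathbb{R}_{\geq0}\times\mathbb{R}^n: B(t,x)\le0\}$, and such that $$\Big\langle \nabla B(t,x),\begin{bmatrix}1\\ F(x)\end{bmatrix}\Big\rangle\le 0\qquad \forall (t,x)\in(\mathbb{R}_{\geq0}\times\mathbb{R}^n)\setminus K.$$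
   Context: Solutions of $\dot x=F(x)$ are absolutely continuous functions on intervals $[0,T]$ or $[0,T)$, $T\in[0,\infty]$, satisfying the equation almost everywhere. A solution is maximal if it cannot be extended; the system is forward complete if every maximal solution has unbounded domain, and backward complete if $\dot x=-F(x)$ is forward complete. The system is safe with respect to $(X_o,X_u)$ if every solution starting in $X_o$ never takes values in $X_u$. A time-varying barrier function candidate for safety with respect to $(X_o,X_u)$ is a function $B:\mathbb{R}_{\geq0}\times\mathbb{R}^n\to\mathbb{R}$ with $B(t,x)>0$ for all $(t,x)\in\mathbb{R}_{\geq0}\times X_u$ and $B(t,x)\le0$ for all $(t,x)\in\mathbb{R}_{\geq0}\times X_o$. $\nabla B(t,x)\in\mathbb{R}^{n+1}$ denotes the gradient with respect to $(t,x)$. *)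

theory Defs
  imports "HOL-Analysis.Analysis"
begin

definition ac_on_compact :: "real \<Rightarrow> real \<Rightarrow> (real \<Rightarrow> 'a::real_normed_vector) \<Rightarrow> bool" where
  "ac_on_compact lo hi f \<longleftrightarrow>
     (\<forall>\<epsilon>>0. \<exists>\<delta>>0. \<forall>(n::nat) (a::nat \<Rightarrow> real) (b::nat \<Rightarrow> real).
        (\<forall>k<n. a k \<le> b k \<and> {a k..b k} \<subseteq> {lo..hi})
        \<and> (\<forall>i<n. \<forall>j<n. i \<noteq> j \<longrightarrow> {a i<..<b i} \<inter> {a j<..<b j} = {})
        \<and> (\<Sum>k<n. b k - a k) < \<delta>
        \<longrightarrow> (\<Sum>k<n. norm (f (b k) - f (a k))) < \<epsilon>)"

text \<open>Absolute continuity on an interval I: on every compact subinterval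
  (for a compact I this is ordinary absolute continuity on I).\<close>
definition ac_on :: "real set \<Rightarrow> (real \<Rightarrow> 'a::real_normed_vector) \<Rightarrow> bool" where
  "ac_on I f \<longleftrightarrow> (\<forall>c d. {c..d} \<subseteq> I \<longrightarrow> ac_on_compact c d f)"

definition ode_solution :: "('a::euclidean_space \<Rightarrow> 'a) \<Rightarrow> real set \<Rightarrow> (real \<Rightarrow> 'a) \<Rightarrow> bool" where
  "ode_solution F I x \<longleftrightarrow>
     ((\<exists>T\<ge>0. I = {0..T}) \<or> (\<exists>T>0. I = {0..<T}) \<or> I = {0..})
     \<and> ac_on I x
     \<and> (AE t in lebesgue. t \<in> I \<longrightarrow> (x has_vector_derivative F (x t)) (at t within I))"

definition maximal_solution :: "('a::euclidean_space \<Rightarrow> 'a) \<Rightarrow> real set \<Rightarrow> (real \<Rightarrow> 'a) \<Rightarrow> bool" where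
  "maximal_solution F I x \<longleftrightarrow> ode_solution F I x \<and>
     \<not> (\<exists>J y. ode_solution F J y \<and> I \<subset> J \<and> (\<forall>t\<in>I. y t = x t))"

definition forward_complete :: "('a::euclidean_space \<Rightarrow> 'a) \<Rightarrow> bool" where
  "forward_complete F \<longleftrightarrow> (\<forall>I x. maximal_solution F I x \<longrightarrow> \<not> bounded I)"

definition backward_complete :: "('a::euclidean_space \<Rightarrow> 'a) \<Rightarrow> bool" where
  "backward_complete F \<longleftrightarrow> forward_complete (\<lambda>x. - F x)"

definition safe :: "('a::euclidean_space \<Rightarrow> 'a) \<Rightarrow> 'a set \<Rightarrow> 'a set \<Rightarrow> bool" where
  "safe F Xo Xu \<longleftrightarrow> (\<forall>I x. ode_solution F I x \<and> x 0 \<in> Xo \<longrightarrow> (\<forall>t\<in>I. x t \<notin> Xu))"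

definition barrier_candidate :: "'a set \<Rightarrow> 'a set \<Rightarrow> (real \<Rightarrow> 'a \<Rightarrow> real) \<Rightarrow> bool" where
  "barrier_candidate Xo Xu B \<longleftrightarrow>
     (\<forall>t\<ge>0. \<forall>x\<in>Xu. B t x > 0) \<and> (\<forall>t\<ge>0. \<forall>x\<in>Xo. B t x \<le> 0)"

end

theory Submission
  imports Defs
begin

text \<open>
  If a barrier is positive at the end of a solution issued from \<open>Xo\<close>, then after the last time at which
  it is nonpositive it is nonincreasing along the solution, a contradiction.

  For the converse no differentiability of the flow is needed. Given \<open>t0 \<ge> 0\<close> and \<open>x0 \<in> Xu\<close>, follow the
  backward solution from \<open>x0\<close> for time \<open>t0\<close>; read forward it is a solution \<open>\<gamma>\<close> with \<open>\<gamma> t0 = x0\<close>, which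
  by safety avoids the closed set \<open>Xo\<close>. A one-sided Gronwall estimate makes
  \<open>w (t, x) = exp (M t) |x - \<gamma> t|\<^sup>2\<close> nondecreasing along solutions near \<open>\<gamma>\<close>, so a decreasing function of
  \<open>w\<close> times a decreasing function of \<open>t\<close> is a \<open>C\<^sup>1\<close> function that is nonincreasing along solutions, is
  supported in a tube around \<open>\<gamma>\<close> missing \<open>Xo\<close>, and is positive at \<open>(t0, x0)\<close>. By the Lindelof property
  countably many of these cover \<open>[0, \<infinity>) \<times> Xu\<close>, and a weighted sum of them is the barrier.
\<close>


section \<open>Absolute continuity and the fundamental theorem of calculus\<close>

text \<open>A bijection with \<open>{..<card I}\<close> carries the definition, which numbers its
  intervals, over to arbitrary finite index sets. In
  \<open>fundamental_theorem_of_calculus_ac\<close> the index set consists of elements of a tagged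
  division.\<close>

lemma ac_on_compact_finite_sum_less:
  fixes f :: "real \<Rightarrow> 'a::real_normed_vector"
  assumes "ac_on_compact a b f" "e > 0"
  shows "\<exists>d>0. \<forall>(I :: 'i set) l u. finite I \<and> (\<forall>i\<in>I. l i \<le> u i \<and> {l i..u i} \<subseteq> {a..b}) \<and>
      (\<forall>i\<in>I. \<forall>j\<in>I. i \<noteq> j \<longrightarrow> {l i<..<u i} \<inter> {l j<..<u j} = {}) \<and>
      (\<Sum>i\<in>I. u i - l i) < d \<longrightarrow> (\<Sum>i\<in>I. norm (f (u i) - f (l i))) < e"
proof -
  obtain d where d: "d > 0" and D: "\<forall>(n::nat) l u.
        (\<forall>k<n. l k \<le> u k \<and> {l k..u k} \<subseteq> {a..b})
        \<and> (\<forall>i<n. \<forall>j<n. i \<noteq> j \<longrightarrow> {l i<..<u i} \<inter> {l j<..<u j} = {})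
        \<and> (\<Sum>k<n. u k - l k) < d
        \<longrightarrow> (\<Sum>k<n. norm (f (u k) - f (l k))) < e"
    using assms(1)[unfolded ac_on_compact_def, rule_format, OF assms(2)] by blast
  have key: "(\<Sum>i\<in>I. norm (f (u i) - f (l i))) < e"
    if fin: "finite I" and le: "\<forall>i\<in>I. l i \<le> u i \<and> {l i..u i} \<subseteq> {a..b}"
      and disj: "\<forall>i\<in>I. \<forall>j\<in>I. i \<noteq> j \<longrightarrow> {l i<..<u i} \<inter> {l j<..<u j} = {}"
      and sm: "(\<Sum>i\<in>I. u i - l i) < d" for I :: "'i set" and l u
  proof -
    obtain h where h: "bij_betw h {..<card I} I"
      using ex_bij_betw_nat_finite[OF fin] by (auto simp: atLeast0LessThan)
    have hI: "h k \<in> I" if "k < card I" for k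
      using h that by (auto simp: bij_betw_def)
    have hne: "h i \<noteq> h j" if "i < card I" "j < card I" "i \<noteq> j" for i j
      using h that by (auto simp: bij_betw_def inj_on_def)
    have "(\<Sum>k<card I. norm (f (u (h k)) - f (l (h k)))) < e"
    proof (rule D[rule_format], intro conjI allI impI)
      show "(\<Sum>k<card I. u (h k) - l (h k)) < d"
        using sm sum.reindex_bij_betw[OF h, of "\<lambda>i. u i - l i"] by simp
      show "{l (h i)<..<u (h i)} \<inter> {l (h j)<..<u (h j)} = {}"
        if "i < card I" "j < card I" "i \<noteq> j" for i j
        using disj[rule_format, OF hI hI hne] that by blast
    qed (use le hI in auto)
    then show ?thesis
      using sum.reindex_bij_betw[OF h, of "\<lambda>i. norm (f (u i) - f (l i))"] by simp
  qed
  show ?thesis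
    by (rule exI[of _ d], intro conjI allI impI, rule d, elim conjE, rule key; assumption)
qed

lemma sum_lengths_le_measure:
  fixes l u :: "'i \<Rightarrow> real"
  assumes "finite I" "\<And>i. i \<in> I \<Longrightarrow> l i \<le> u i"
    "\<And>i j. i \<in> I \<Longrightarrow> j \<in> I \<Longrightarrow> i \<noteq> j \<Longrightarrow> {l i<..<u i} \<inter> {l j<..<u j} = {}"
    "\<And>i. i \<in> I \<Longrightarrow> {l i<..<u i} \<subseteq> U" "U \<in> lmeasurable"
  shows "(\<Sum>i\<in>I. u i - l i) \<le> measure lebesgue U"
proof -
  have m: "{l i<..<u i} \<in> lmeasurable" for i
    by (metis lmeasurable_box box_real(1))
  have "(\<Sum>i\<in>I. u i - l i) = (\<Sum>i\<in>I. measure lebesgue {l i<..<u i})"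
    using assms(2) by (intro sum.cong) auto
  also have "\<dots> = measure lebesgue (\<Union>i\<in>I. {l i<..<u i})"
    using assms(1,3) m fmeasurableD2[OF m]
    by (intro measure_finite_Union[symmetric]) (auto simp: disjoint_family_on_def top.not_eq_extremum)
  also have "\<dots> \<le> measure lebesgue U"
    using assms(1,4,5) m by (intro measure_mono_fmeasurable) auto
  finally show ?thesis .
qed

text \<open>The gauge integral permits a direct estimate of the Riemann sums. An element with its
  tag outside \<open>N\<close> is controlled by differentiability at the tag. The elements with tags
  in \<open>N\<close> are kept inside an open set of measure less than \<open>d\<close>, so absolute
  continuity bounds the sum of the increments of \<open>f\<close> over them.\<close>

theorem fundamental_theorem_of_calculus_ac:
  fixes f :: "real \<Rightarrow> 'a::banach"
  assumes "a \<le> b" and ac: "ac_on_compact a b f" and N: "negligible N"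
    and deriv: "\<And>t. t \<in> {a..b} - N \<Longrightarrow> (f has_vector_derivative g t) (at t within {a..b})"
  shows "(g has_integral (f b - f a)) {a..b}"
proof -
  \<comment> \<open>With the value 0 on \<open>N\<close>, an element tagged in \<open>N\<close>
    leaves only the increment of \<open>f\<close> in its error; the integral is unaffected because
    \<open>N\<close> is negligible.\<close>
  define g' where "g' t = (if t \<in> N then 0 else g t)" for t
  have "(g' has_integral (f b - f a)) {a..b}"
    unfolding has_integral_real
  proof (intro allI impI)
    fix e :: real assume "e > 0"
    \<comment> \<open>Errors of at most \<open>e1\<close> times the length add up to at most
      \<open>e / 2\<close>; the summand 1 covers the case \<open>a = b\<close>.\<close>
    define e1 where "e1 = e / (2 * (b - a + 1))"
    have "e1 > 0" using \<open>a \<le> b\<close> \<open>e > 0\<close> by (simp add: e1_def)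
    obtain d where d: "d > 0" and D: "\<forall>(I :: (real \<times> real set) set) l u. finite I \<and>
      (\<forall>i\<in>I. l i \<le> u i \<and> {l i..u i} \<subseteq> {a..b}) \<and>
      (\<forall>i\<in>I. \<forall>j\<in>I. i \<noteq> j \<longrightarrow> {l i<..<u i} \<inter> {l j<..<u j} = {}) \<and>
      (\<Sum>i\<in>I. u i - l i) < d \<longrightarrow> (\<Sum>i\<in>I. norm (f (u i) - f (l i))) < e/2"
      using ac_on_compact_finite_sum_less[OF ac half_gt_zero[OF \<open>e > 0\<close>]] by blast
    obtain U where U: "open U" "N \<subseteq> U" "U \<in> lmeasurable" "measure lebesgue U < d"
    proof -
      obtain U where "open U" "N \<subseteq> U" "U - N \<in> lmeasurable" "emeasure lebesgue (U - N) < ennreal d"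
        using sets_lebesgue_outer_open[of N d] N d
        by (metis fmeasurableD negligible_imp_measurable)
      moreover have "U = (U - N) \<union> N" using \<open>N \<subseteq> U\<close> by blast
      ultimately show thesis
        using that N negligible_imp_measurable[OF N] fmeasurable.Un measure_Un_null_set[of "U - N" lebesgue N]
        by (metis emeasure_eq_measure2 ennreal_less_iff fmeasurableD measure_nonneg negligible_iff_null_sets)
    qed
    have "\<exists>r>0. \<forall>s\<in>{a..b}. \<bar>s - t\<bar> < r \<longrightarrow> norm (f s - f t - (s - t) *\<^sub>R g t) \<le> e1 * \<bar>s - t\<bar>"
      if "t \<in> {a..b} - N" for t
      using deriv[OF that, unfolded has_vector_derivative_def has_derivative_within_alt] \<open>e1 > 0\<close>
      by auto
    then have "\<forall>t\<in>{a..b} - N. \<exists>r>0. \<forall>s\<in>{a..b}. \<bar>s - t\<bar> < r \<longrightarrow> norm (f s - f t - (s - t) *\<^sub>R g t) \<le> e1 * \<bar>s - t\<bar>"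
      by blast
    from bchoice[OF this] obtain r where r: "\<And>t. t \<in> {a..b} - N \<Longrightarrow> r t > 0"
      "\<And>t s. t \<in> {a..b} - N \<Longrightarrow> s \<in> {a..b} \<Longrightarrow> \<bar>s - t\<bar> < r t \<Longrightarrow>
         norm (f s - f t - (s - t) *\<^sub>R g t) \<le> e1 * \<bar>s - t\<bar>"
      by blast
    define \<gamma> where "\<gamma> t = (if t \<in> N then U else if t \<in> {a..b} then ball t (r t) else UNIV)" for t
    have "gauge \<gamma>"
      using U r by (auto simp: gauge_def \<gamma>_def)
    moreover have "norm ((\<Sum>(x,k)\<in>\<D>. measure lborel k *\<^sub>R g' x) - (f b - f a)) < e"
      if \<D>: "\<D> tagged_division_of {a..b}" "\<gamma> fine \<D>" for \<D>
    proof -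
      note fin = tagged_division_ofD(1)[OF \<D>(1)]
      let ?l = "\<lambda>p::real \<times> real set. Inf (snd p)" and ?u = "\<lambda>p::real \<times> real set. Sup (snd p)"
      have K: "snd p = {?l p..?u p}" "?l p \<le> ?u p" "fst p \<in> snd p" "snd p \<subseteq> {a..b}" 
          "snd p \<subseteq> \<gamma> (fst p)" "measure lborel (snd p) = ?u p - ?l p" if "p \<in> \<D>" for p
      proof -
        obtain x k where p: "p = (x,k)" by force
        have xk: "(x, k) \<in> \<D>" using that p by simp
        obtain c d where "k = cbox c d" using tagged_division_ofD(4)[OF \<D>(1) xk] by blast
        then have k: "k = {c..d}" "x \<in> k" "k \<subseteq> {a..b}"
          using tagged_division_ofD(2,3)[OF \<D>(1) xk] by auto
        then show "snd p = {?l p..?u p}" "?l p \<le> ?u p" "fst p \<in> snd p" "snd p \<subseteq> {a..b}" 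
          "measure lborel (snd p) = ?u p - ?l p"
          using p by auto
        show "snd p \<subseteq> \<gamma> (fst p)" using \<D>(2) that p by (auto simp: fine_def)
      qed
      have disj: "{?l p<..<?u p} \<inter> {?l q<..<?u q} = {}" if "p \<in> \<D>" "q \<in> \<D>" "p \<noteq> q" for p q
      proof -
        have "interior (snd p) \<inter> interior (snd q) = {}"
          using tagged_division_ofD(5)[OF \<D>(1), of "fst p" "snd p" "fst q" "snd q"] that by auto
        then show ?thesis using K(1)[OF that(1)] K(1)[OF that(2)] interior_atLeastAtMost_real by metis
      qed
      let ?E = "\<lambda>p. measure lborel (snd p) *\<^sub>R g' (fst p) - (f (?u p) - f (?l p))"
      let ?B = "{p\<in>\<D>. fst p \<in> N}" and ?G = "{p\<in>\<D>. fst p \<notin> N}"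
      have "(\<Sum>(x,k)\<in>\<D>. measure lborel k *\<^sub>R g' x) - (f b - f a) = (\<Sum>p\<in>\<D>. ?E p)"
        using additive_tagged_division_1[OF \<open>a \<le> b\<close> \<D>(1), of f]
        by (simp add: sum_subtractf case_prod_unfold)
      also have "norm \<dots> \<le> (\<Sum>p\<in>\<D>. norm (?E p))"
        by (rule norm_sum)
      also have "\<dots> = (\<Sum>p\<in>?G. norm (?E p)) + (\<Sum>p\<in>?B. norm (?E p))"
        using fin by (subst sum.union_disjoint[symmetric]) (auto intro!: sum.cong)
      also have "(\<Sum>p\<in>?G. norm (?E p)) \<le> (\<Sum>p\<in>?G. e1 * measure lborel (snd p))"
      proof (intro sum_mono)
        fix p assume p: "p \<in> ?G"
        then have pD: "p \<in> \<D>" and pN: "fst p \<in> {a..b} - N" using K(3,4)[of p] by auto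
        have "snd p \<subseteq> ball (fst p) (r (fst p))"
          using K(5)[OF pD] pN by (simp add: \<gamma>_def)
        moreover have lu: "?l p \<in> snd p" "?u p \<in> snd p" 
          using K(1,2)[OF pD] by (metis atLeastAtMost_iff order_refl)+
        ultimately have "\<bar>?l p - fst p\<bar> < r (fst p)" "\<bar>?u p - fst p\<bar> < r (fst p)"
          by (auto simp: dist_real_def subset_iff abs_minus_commute)
        moreover have "?l p \<in> {a..b}" "?u p \<in> {a..b}" using lu K(4)[OF pD] by auto
        ultimately have "norm (f (?l p) - f (fst p) - (?l p - fst p) *\<^sub>R g (fst p)) \<le> e1 * \<bar>?l p - fst p\<bar>"
            "norm (f (?u p) - f (fst p) - (?u p - fst p) *\<^sub>R g (fst p)) \<le> e1 * \<bar>?u p - fst p\<bar>"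
          using r(2)[OF pN] by auto
        \<comment> \<open>The element is split at its tag: each end point is compared with the tag,
          and since the tag lies between them the two errors add up to at most \<open>e1\<close>
          times the length.\<close>
        moreover have "?E p = (f (?l p) - f (fst p) - (?l p - fst p) *\<^sub>R g (fst p))
            - (f (?u p) - f (fst p) - (?u p - fst p) *\<^sub>R g (fst p))"
          unfolding K(6)[OF pD] using pN by (simp add: g'_def algebra_simps)
        ultimately have "norm (?E p) \<le> e1 * \<bar>?l p - fst p\<bar> + e1 * \<bar>?u p - fst p\<bar>"
          by (simp only: norm_triangle_le_diff add_mono)
        moreover have "?l p \<le> fst p" "fst p \<le> ?u p"
          using K(1,3)[OF pD] by (metis atLeastAtMost_iff)+
        ultimately show "norm (?E p) \<le> e1 * measure lborel (snd p)"
          unfolding K(6)[OF pD] by (simp add: right_diff_distrib)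
      qed
      also have "\<dots> \<le> (\<Sum>p\<in>\<D>. e1 * measure lborel (snd p))"
        using fin \<open>e1 > 0\<close> by (intro sum_mono2) auto
      also have "\<dots> = e1 * (b - a)"
        using additive_content_tagged_division[of \<D> a b] \<D>(1) \<open>a \<le> b\<close>
        by (simp add: sum_distrib_left[symmetric] case_prod_unfold)
      also have "\<dots> \<le> e / 2"
        using \<open>a \<le> b\<close> \<open>e > 0\<close> by (simp add: e1_def field_simps)
      also have "(\<Sum>p\<in>?B. norm (?E p)) = (\<Sum>p\<in>?B. norm (f (?u p) - f (?l p)))"
        by (intro sum.cong) (auto simp: g'_def norm_minus_commute)
      also have "\<dots> < e / 2"
      proof (rule D[rule_format], intro conjI)
        have "(\<Sum>p\<in>?B. ?u p - ?l p) \<le> measure lebesgue U"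
        proof (rule sum_lengths_le_measure)
          fix p assume "p \<in> ?B"
          then have "snd p \<subseteq> U" using K(5)[of p] by (auto simp: \<gamma>_def)
          then show "{?l p<..<?u p} \<subseteq> U" using K(1)[of p] \<open>p \<in> ?B\<close>
            by (metis (no_types, lifting) greaterThanLessThan_subseteq_atLeastAtMost_iff mem_Collect_eq
                order_refl order_trans)
        qed (use fin K disj U in auto)
        then show "(\<Sum>p\<in>?B. ?u p - ?l p) < d" using U by simp
      qed (use fin K disj in \<open>auto\<close>)
      finally show ?thesis by simp
    qed
    ultimately show "\<exists>\<gamma>. gauge \<gamma> \<and> (\<forall>\<D>. \<D> tagged_division_of {a..b} \<and> \<gamma> fine \<D> \<longrightarrow>
        norm ((\<Sum>(x,k)\<in>\<D>. measure lborel k *\<^sub>R g' x) - (f b - f a)) < e)"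
      by (intro exI[of _ \<gamma>] conjI allI impI) auto
  qed
  then show ?thesis
    using N by (rule has_integral_spike[rotated 2]) (auto simp: g'_def)
qed


section \<open>Absolutely continuous solutions as classical solutions\<close>

lemma ac_on_compact_subset:
  assumes ac: "ac_on_compact a b f" and sub: "{c..d} \<subseteq> {a..b}"
  shows "ac_on_compact c d f"
  unfolding ac_on_compact_def
proof (intro allI impI, goal_cases)
  case (1 e)
  obtain r where "r > 0" and r: "\<forall>(n::nat) l u.
        (\<forall>k<n. l k \<le> u k \<and> {l k..u k} \<subseteq> {a..b})
        \<and> (\<forall>i<n. \<forall>j<n. i \<noteq> j \<longrightarrow> {l i<..<u i} \<inter> {l j<..<u j} = {})
        \<and> (\<Sum>k<n. u k - l k) < r
        \<longrightarrow> (\<Sum>k<n. norm (f (u k) - f (l k))) < e"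
    using ac[unfolded ac_on_compact_def, rule_format, OF 1] by blast
  show ?case
  proof (rule exI[of _ r], intro conjI allI impI, rule \<open>r > 0\<close>, elim conjE, goal_cases)
    case (1 n l u)
    have "l k \<le> u k \<and> {l k..u k} \<subseteq> {a..b}" if "k < n" for k
      using 1(1) sub that by (meson order_trans)
    with 1(2,3) show ?case using r by presburger
  qed
qed

text \<open>By the fundamental theorem \<open>f\<close> is \<open>f a\<close> plus the integral of
  the continuous function \<open>g\<close>, and such an integral is differentiable at every point.
  This removes the exceptional null set from the notion of solution.\<close>

lemma ac_on_compact_imp_has_vector_derivative:
  fixes f :: "real \<Rightarrow> 'a::banach"
  assumes ac: "ac_on_compact a b f" and N: "negligible N"
    and deriv: "\<And>t. t \<in> {a..b} - N \<Longrightarrow> (f has_vector_derivative g t) (at t within {a..b})"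
    and g: "continuous_on {a..b} g" and t: "t \<in> {a..b}"
  shows "(f has_vector_derivative g t) (at t within {a..b})"
proof -
  have "f s = f a + integral {a..s} g" if s: "s \<in> {a..b}" for s
  proof -
    have "(g has_integral (f s - f a)) {a..s}"
    proof (rule fundamental_theorem_of_calculus_ac[OF _ _ N])
      show "ac_on_compact a s f"
        using ac by (rule ac_on_compact_subset) (use s in auto)
      show "(f has_vector_derivative g u) (at u within {a..s})" if "u \<in> {a..s} - N" for u
        using deriv[of u] that s by (auto intro: has_vector_derivative_within_subset)
    qed (use s in auto)
    then show ?thesis by (simp add: integral_unique)
  qed
  moreover have "((\<lambda>s. f a + integral {a..s} g) has_vector_derivative g t) (at t within {a..b})"
    using integral_has_vector_derivative[OF g t] by (auto intro!: derivative_eq_intros)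
  ultimately show ?thesis
    by (rule has_vector_derivative_transform[OF t])
qed

lemma ac_on_compact_imp_continuous_on:
  assumes ac: "ac_on_compact a b f"
  shows "continuous_on {a..b} f"
  unfolding continuous_on_iff
proof (intro ballI allI impI)
  fix s e :: real assume s: "s \<in> {a..b}" and "e > 0"
  obtain d where "d > 0" and d: "\<And>(n::nat) l u.
        (\<forall>k<n. l k \<le> u k \<and> {l k..u k} \<subseteq> {a..b})
        \<and> (\<forall>i<n. \<forall>j<n. i \<noteq> j \<longrightarrow> {l i<..<u i} \<inter> {l j<..<u j} = {})
        \<and> (\<Sum>k<n. u k - l k) < d
        \<Longrightarrow> (\<Sum>k<n. norm (f (u k) - f (l k))) < e"
    using ac[unfolded ac_on_compact_def, rule_format, OF \<open>e > 0\<close>] by blast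
  have "dist (f r) (f s) < e" if r: "r \<in> {a..b}" "dist r s < d" for r
  proof (cases "r \<le> s")
    case True
    then show ?thesis using d[of 1 "\<lambda>_. r" "\<lambda>_. s"] r s
      by (auto simp: dist_norm norm_minus_commute)
  next
    case False
    then show ?thesis using d[of 1 "\<lambda>_. s" "\<lambda>_. r"] r s
      by (auto simp: dist_norm)
  qed
  then show "\<exists>d>0. \<forall>r\<in>{a..b}. dist r s < d \<longrightarrow> dist (f r) (f s) < e"
    using \<open>d > 0\<close> by blast
qed

lemma lipschitz_imp_ac_on_compact:
  fixes f :: "real \<Rightarrow> 'a::real_normed_vector"
  assumes lip: "\<And>s t. s \<in> {a..b} \<Longrightarrow> t \<in> {a..b} \<Longrightarrow> norm (f t - f s) \<le> C * norm (t - s)"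
  shows "ac_on_compact a b f"
  unfolding ac_on_compact_def
proof (intro allI impI, goal_cases)
  case (1 e)
  \<comment> \<open>\<open>C\<close> may be zero or negative, hence the divisor
    \<open>\<bar>C\<bar> + 1\<close>.\<close>
  show ?case
  proof (intro exI[of _ "e / (\<bar>C\<bar> + 1)"] conjI allI impI, goal_cases)
    case 1
    then show ?case using \<open>e > 0\<close> by simp
  next
    case (2 n l u)
    have "(\<Sum>k<n. norm (f (u k) - f (l k))) \<le> (\<Sum>k<n. (\<bar>C\<bar> + 1) * (u k - l k))"
    proof (intro sum_mono)
      fix k assume "k \<in> {..<n}"
      then have k: "l k \<le> u k" "{l k..u k} \<subseteq> {a..b}" using 2 by auto
      then have "norm (f (u k) - f (l k)) \<le> C * (u k - l k)"
        using lip[of "l k" "u k"] by auto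
      also have "\<dots> \<le> (\<bar>C\<bar> + 1) * (u k - l k)"
        using k by (intro mult_right_mono) auto
      finally show "norm (f (u k) - f (l k)) \<le> (\<bar>C\<bar> + 1) * (u k - l k)" .
    qed
    also have "\<dots> = (\<bar>C\<bar> + 1) * (\<Sum>k<n. u k - l k)"
      by (simp add: sum_distrib_left)
    also have "\<dots> < (\<bar>C\<bar> + 1) * (e / (\<bar>C\<bar> + 1))"
      using 2 by (intro mult_strict_left_mono) auto
    finally show ?case by simp
  qed
qed

text \<open>A form of the three admissible domains without cases, which can be checked directly for
  the union of a chain. An initial segment of the half-line is determined by its supremum and by
  whether the supremum is attained.\<close>

lemma time_interval_iff:
  "((\<exists>T\<ge>0. I = {0..T}) \<or> (\<exists>T>0. I = {0..<T}) \<or> I = {0..}) \<longleftrightarrow>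
    (0::real) \<in> I \<and> I \<subseteq> {0..} \<and> (\<forall>t\<in>I. {0..t} \<subseteq> I)"
proof
  assume I: "0 \<in> I \<and> I \<subseteq> {0..} \<and> (\<forall>t\<in>I. {0..t} \<subseteq> I)"
  show "(\<exists>T\<ge>0. I = {0..T}) \<or> (\<exists>T>0. I = {0..<T}) \<or> I = {0..}"
  proof (cases "bdd_above I")
    case False
    have "t \<in> I" if "t \<ge> 0" for t
    proof -
      obtain s where "s \<in> I" "t < s" using False by (meson bdd_above.I not_le)
      then show ?thesis using I that by force
    qed
    then show ?thesis using I by blast
  next
    case True
    have le: "t \<le> Sup I" if "t \<in> I" for t using True that by (rule cSup_upper[rotated])
    have lt: "t \<in> I" if t: "0 \<le> t" "t < Sup I" for t
    proof -
      obtain s where "s \<in> I" "t < s" using less_cSupD[of I t] t I by blast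
      then show ?thesis using I t by force
    qed
    show ?thesis
    proof (cases "Sup I \<in> I")
      case True
      then have "I = {0..Sup I}" "Sup I \<ge> 0" using I le by auto
      then show ?thesis by blast
    next
      case False
      then have "Sup I > 0" using le[of 0] I by (metis order_le_less)
      moreover have "I = {0..<Sup I}"
      proof (intro equalityI subsetI)
        fix t assume "t \<in> I"
        then show "t \<in> {0..<Sup I}" using I le[of t] False by (cases "t = Sup I") auto
      qed (simp add: lt)
      ultimately show ?thesis by blast
    qed
  qed
qed auto

text \<open>For continuous \<open>F\<close> the function \<open>F (x t)\<close> is continuous along
  a solution, so the derivative exists everywhere. Conversely it is bounded on compact intervals, so
  a classical solution is locally Lipschitz and thus absolutely continuous. The condition is stated
  on each \<open>{0..d}\<close> separately, so that it passes to unions of nested solutions.\<close>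

lemma ode_solution_iff:
  fixes F :: "'a::euclidean_space \<Rightarrow> 'a"
  assumes F: "continuous_on UNIV F"
  shows "ode_solution F I x \<longleftrightarrow> 0 \<in> I \<and> I \<subseteq> {0..} \<and> (\<forall>d\<in>I. {0..d} \<subseteq> I \<and>
    (\<forall>t\<in>{0..d}. (x has_vector_derivative F (x t)) (at t within {0..d})))"
    (is "_ \<longleftrightarrow> ?R")
proof
  assume sol: "ode_solution F I x"
  then have I: "0 \<in> I" "I \<subseteq> {0..}" "\<And>t. t \<in> I \<Longrightarrow> {0..t} \<subseteq> I"
    unfolding ode_solution_def time_interval_iff by blast+
  obtain N where N: "negligible N"
    and D: "\<And>t. t \<in> I - N \<Longrightarrow> (x has_vector_derivative F (x t)) (at t within I)"
  proof -
    have "AE t in lebesgue. t \<in> I \<longrightarrow> (x has_vector_derivative F (x t)) (at t within I)"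
      using sol unfolding ode_solution_def by blast
    then obtain N where "{t \<in> space lebesgue. \<not> (t \<in> I \<longrightarrow> (x has_vector_derivative F (x t)) (at t within I))} \<subseteq> N"
       "N \<in> null_sets lebesgue" by (rule AE_E3) blast
    then show thesis
      using that[of N] by (auto simp: negligible_iff_null_sets)
  qed
  have "(x has_vector_derivative F (x t)) (at t within {0..d})" if "d \<in> I" "t \<in> {0..d}" for d t
  proof (rule ac_on_compact_imp_has_vector_derivative[OF _ N _ _ that(2)])
    show ac: "ac_on_compact 0 d x"
      using sol I(3)[OF \<open>d \<in> I\<close>] unfolding ode_solution_def ac_on_def by blast
    show "(x has_vector_derivative F (x s)) (at s within {0..d})" if "s \<in> {0..d} - N" for s
      using D[of s] that I(3)[OF \<open>d \<in> I\<close>] has_vector_derivative_within_subset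
      by (metis Diff_iff subsetD)
    show "continuous_on {0..d} (\<lambda>s. F (x s))"
      using ac_on_compact_imp_continuous_on[OF ac] F by (auto intro: continuous_on_compose2)
  qed
  then show ?R using I by blast
next
  assume ?R
  then have I: "0 \<in> I" "I \<subseteq> {0..}" "\<And>t. t \<in> I \<Longrightarrow> {0..t} \<subseteq> I"
    and D: "\<And>d t. d \<in> I \<Longrightarrow> t \<in> {0..d} \<Longrightarrow> (x has_vector_derivative F (x t)) (at t within {0..d})"
    by auto
  have "ac_on_compact c d x" if "{c..d} \<subseteq> I" for c d
  proof (cases "c \<le> d")
    case False
    then show ?thesis by (intro lipschitz_imp_ac_on_compact[of _ _ _ 0]) auto
  next
    case True
    then have d: "d \<in> I" and c: "0 \<le> c" using that I by auto
    have cont: "continuous_on {0..d} x"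
      using D[OF d] by (rule continuous_on_vector_derivative)
    have "compact ((\<lambda>s. F (x s)) ` {0..d})"
      using cont F by (intro compact_continuous_image) (auto intro: continuous_on_compose2)
    then obtain C where C: "\<And>s. s \<in> {0..d} \<Longrightarrow> norm (F (x s)) \<le> C"
      by (metis bounded_iff compact_imp_bounded imageI)
    show ?thesis
    proof (rule lipschitz_imp_ac_on_compact)
      fix s t assume "s \<in> {c..d}" "t \<in> {c..d}"
      then have st: "s \<in> {0..d}" "t \<in> {0..d}" using c by auto
      show "norm (x t - x s) \<le> C * norm (t - s)"
      proof (rule differentiable_bound[OF convex_closed_interval _ _ st(2,1)])
        show "(x has_derivative (\<lambda>h. h *\<^sub>R F (x u))) (at u within {0..d})" if "u \<in> {0..d}" for u
          using D[OF d that] by (simp add: has_vector_derivative_def)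
        show "onorm (\<lambda>h. h *\<^sub>R F (x u)) \<le> C" if "u \<in> {0..d}" for u
          using C[OF that] by (auto simp: onorm_scaleR_left onorm_id intro: onorm_bound)
      qed
    qed
  qed
  \<comment> \<open>If some \<open>d\<close> in \<open>I\<close> exceeds \<open>t\<close>, then
    \<open>I\<close> and \<open>{0..d}\<close> agree near \<open>t\<close>; otherwise
    \<open>t\<close> is the last point and \<open>I = {0..t}\<close>.\<close>
  moreover have "(x has_vector_derivative F (x t)) (at t within I)" if t: "t \<in> I" for t
  proof (cases "\<exists>d\<in>I. t < d")
    case True
    then obtain d where d: "d \<in> I" "t < d" by blast
    have "at t within I = at t within {0..d}"
      using d I by (intro at_within_nhd[of t "{..<d}"]) (auto simp: less_imp_le)
    then show ?thesis using D[OF d(1), of t] d t I by auto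
  next
    case False
    then have "I = {0..t}" using I(2) I(3)[OF t] by fastforce
    then show ?thesis using D[OF t, of t] t I by auto
  qed
  ultimately show "ode_solution F I x"
    unfolding ode_solution_def time_interval_iff ac_on_def using I by (auto intro!: AE_I2)
qed


section \<open>Global solutions from completeness\<close>

text \<open>Zorn's lemma, applied to the solutions through \<open>x0\<close> ordered by extension,
  gives a maximal one. Completeness makes its domain unbounded, and an unbounded initial segment is
  the whole half-line.\<close>

lemma forward_complete_global_solution:
  fixes F :: "'a::euclidean_space \<Rightarrow> 'a"
  assumes F: "continuous_on UNIV F" and fc: "forward_complete F"
  obtains x where "ode_solution F {0..} x" "x 0 = x0"
proof -
  \<comment> \<open>Solutions are total functions. Their graphs over the domains forget the values
    elsewhere and turn extension into inclusion.\<close>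
  define graph where "graph I x = (\<lambda>t. (t, x t)) ` I" for I :: "real set" and x :: "real \<Rightarrow> 'a"
  have graph_mono: "I \<subseteq> J \<and> (\<forall>t\<in>I. y t = x t)" if "graph I x \<subseteq> graph J y" for I J x y
    using that by (auto simp: graph_def)
  define A where "A = {graph I x |I x. ode_solution F I x \<and> x 0 = x0}"
  have "\<exists>U\<in>A. \<forall>X\<in>C. X \<subseteq> U" if C: "subset.chain A C" for C
  proof (cases "C = {}")
    case True
    \<comment> \<open>The one-point solution bounds the empty chain: a derivative within a singleton
      imposes no condition on the value.\<close>
    have "ode_solution F {0} (\<lambda>_. x0)"
      unfolding ode_solution_iff[OF F] has_vector_derivative_def
      by (auto simp: has_derivative_within_singleton_iff intro: bounded_linear_scaleR_left)
    then show ?thesis using True by (auto simp: A_def)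
  next
    case False
    have CA: "\<exists>I x. X = graph I x \<and> ode_solution F I x \<and> x 0 = x0" if "X \<in> C" for X
      using C that by (auto simp: subset.chain_def A_def)
    have tot: "X \<subseteq> Y \<or> Y \<subseteq> X" if "X \<in> C" "Y \<in> C" for X Y
      using C that by (auto simp: subset.chain_def)
    define I where "I = fst ` \<Union>C"
    define x where "x t = (SOME v. (t, v) \<in> \<Union>C)" for t
    \<comment> \<open>Of two graphs in the chain one contains the other, so the chosen value
      \<open>x t\<close> coincides with that of every member defined at \<open>t\<close>.\<close>
    have agree: "J \<subseteq> I \<and> (\<forall>t\<in>J. x t = y t)" if J: "graph J y \<in> C" for J y
    proof (intro conjI ballI)
      show "J \<subseteq> I" using J by (force simp: I_def graph_def)
      fix t assume "t \<in> J"
      then have ty: "(t, y t) \<in> graph J y" by (auto simp: graph_def)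
      then have "(t, y t) \<in> \<Union>C" using J by blast
      then have "(t, x t) \<in> \<Union>C" unfolding x_def by (rule someI[of "\<lambda>v. (t, v) \<in> \<Union>C"])
      then obtain X where X: "X \<in> C" "(t, x t) \<in> X" by blast
      obtain K z where "X = graph K z" using CA[OF X(1)] by blast
      then show "x t = y t"
        using tot[OF X(1) J] X(2) ty by (auto simp: graph_def)
    qed
    have IE: "\<exists>J y. graph J y \<in> C \<and> d \<in> J \<and> ode_solution F J y \<and> y 0 = x0" if d: "d \<in> I" for d
    proof -
      obtain X where "X \<in> C" "d \<in> fst ` X" using d unfolding I_def by blast
      moreover obtain J y where "X = graph J y" "ode_solution F J y" "y 0 = x0"
        using CA[OF \<open>X \<in> C\<close>] by blast
      ultimately show ?thesis
        by (intro exI[of _ J] exI[of _ y]) (auto simp: graph_def)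
    qed
    obtain X where "X \<in> C" using False by blast
    obtain J0 y0 where J0: "graph J0 y0 \<in> C" "ode_solution F J0 y0" "y0 0 = x0"
      using CA[OF \<open>X \<in> C\<close>] \<open>X \<in> C\<close> by blast
    have 0: "0 \<in> I" "x 0 = x0"
      using J0(2,3) agree[OF J0(1)] unfolding ode_solution_iff[OF F] by auto
    have D: "0 \<le> d \<and> {0..d} \<subseteq> I \<and> (\<forall>t\<in>{0..d}. (x has_vector_derivative F (x t)) (at t within {0..d}))"
      if d: "d \<in> I" for d
    proof -
      obtain J y where J: "graph J y \<in> C" "d \<in> J" "ode_solution F J y" "y 0 = x0"
        using IE[OF d] by blast
      then have sub: "{0..d} \<subseteq> J" "0 \<le> d"
        and y: "\<And>t. t \<in> {0..d} \<Longrightarrow> (y has_vector_derivative F (y t)) (at t within {0..d})"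
        unfolding ode_solution_iff[OF F] by auto
      have eq: "x t = y t" if "t \<in> {0..d}" for t
        using agree[OF J(1)] sub that by blast
      have "(x has_vector_derivative F (x t)) (at t within {0..d})" if "t \<in> {0..d}" for t
        using has_vector_derivative_transform[OF that eq y[OF that]] eq[OF that] by simp
      then show ?thesis using sub agree[OF J(1)] by blast
    qed
    have "I \<subseteq> {0..}" using D by (meson atLeast_iff subsetI)
    then have "ode_solution F I x"
      unfolding ode_solution_iff[OF F] using 0(1) D by (intro conjI ballI) simp_all
    then have "graph I x \<in> A" using 0 by (auto simp: A_def)
    moreover have "X \<subseteq> graph I x" if X: "X \<in> C" for X
    proof -
      obtain J y where "X = graph J y" using CA[OF X] by blast
      then show ?thesis using agree[of J y] X by (auto simp: graph_def)
    qed
    ultimately show ?thesis by blast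
  qed
  from subset_Zorn[OF this] obtain Gr where "Gr \<in> A" and Gr: "\<forall>X\<in>A. Gr \<subseteq> X \<longrightarrow> X = Gr" ..
  then obtain I x where sol: "ode_solution F I x" "x 0 = x0" and "Gr = graph I x"
    unfolding A_def by blast
  then have max: "\<And>X. X \<in> A \<Longrightarrow> graph I x \<subseteq> X \<Longrightarrow> X = graph I x"
    using Gr by blast
  have I: "0 \<in> I" "I \<subseteq> {0..}" "\<And>t. t \<in> I \<Longrightarrow> {0..t} \<subseteq> I"
    using sol(1) unfolding ode_solution_iff[OF F] by auto
  have "maximal_solution F I x"
    unfolding maximal_solution_def
  proof (intro conjI sol notI, elim exE conjE)
    fix J y assume J: "ode_solution F J y" "I \<subset> J" "\<forall>t\<in>I. y t = x t"
    have "graph J y \<in> A" using J I(1) sol(2) by (auto simp: A_def)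
    moreover have "graph I x \<subseteq> graph J y" using J by (auto simp: graph_def)
    ultimately have "graph J y = graph I x" using max by blast
    then show False using graph_mono[of J y I x] J(2) by blast
  qed
  then have unb: "\<not> bounded I" using fc unfolding forward_complete_def by blast
  have "{0..} \<subseteq> I"
  proof
    fix t :: real assume "t \<in> {0..}"
    have "\<not> I \<subseteq> {0..t}" using unb bounded_subset bounded_closed_interval by blast
    then obtain s where "s \<in> I" "t < s" using I(2) by fastforce
    then show "t \<in> I" using I(3)[of s] \<open>t \<in> {0..}\<close> by auto
  qed
  then have "I = {0..}" using I by blast
  then show thesis using that sol by blast
qed

section \<open>From a barrier to safety\<close>

lemma safe_if_barrier:
  fixes F :: "'a::euclidean_space \<Rightarrow> 'a"
  assumes F: "continuous_on UNIV F"
    and cand: "barrier_candidate Xo Xu B"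
    and cont: "continuous_on ({0..} \<times> UNIV) (\<lambda>(t, x). B t x)"
    and S: "S = ({0..} \<times> UNIV) - {(t, x). t \<ge> 0 \<and> B t x \<le> 0}"
    and DB: "\<And>p. p \<in> S \<Longrightarrow> ((\<lambda>(t, x). B t x) has_derivative blinfun_apply (DB p)) (at p within S)"
    and DB_le: "\<And>t x. (t, x) \<in> S \<Longrightarrow> blinfun_apply (DB (t, x)) (1, F x) \<le> 0"
  shows "safe F Xo Xu"
  unfolding safe_def
proof (intro allI impI ballI notI, elim conjE)
  fix I x b assume sol: "ode_solution F I x" and x0: "x 0 \<in> Xo" and b: "b \<in> I" "x b \<in> Xu"
  have b0: "0 \<le> b" and D: "\<And>t. t \<in> {0..b} \<Longrightarrow> (x has_vector_derivative F (x t)) (at t within {0..b})"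
    using sol b(1) unfolding ode_solution_iff[OF F] by auto
  define g where "g t = B t (x t)" for t
  have contx: "continuous_on {0..b} x"
    using D by (rule continuous_on_vector_derivative)
  have contg: "continuous_on {0..b} g"
    using continuous_on_compose2[OF cont continuous_on_Pair[OF continuous_on_id contx]]
    by (auto simp: g_def image_subset_iff)
  have g0: "g 0 \<le> 0" and gb: "g b > 0"
    using cand x0 b b0 by (auto simp: g_def barrier_candidate_def)
  define Z where "Z = {t \<in> {0..b}. g t \<le> 0}"
  have "Z = {0..b} \<inter> g -` {..0}" by (auto simp: Z_def)
  then have "closed Z"
    using continuous_closed_preimage[OF contg closed_atLeastAtMost closed_atMost] by simp
  moreover have "0 \<in> Z" "bdd_above Z" using g0 b0 by (auto simp: Z_def)
  ultimately have SZ: "Sup Z \<in> Z" by (intro closed_contains_Sup) auto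
  \<comment> \<open>\<open>Z\<close> is closed, so \<open>a\<close> is attained as the last time
    with \<open>g \<le> 0\<close>; from there up to \<open>b\<close> the curve runs in
    \<open>S\<close>.\<close>
  define a where "a = Sup Z"
  have a: "0 \<le> a" "a < b" "g a \<le> 0"
    using SZ gb by (auto simp: Z_def a_def order_less_le)
  have pos: "g t > 0" if "a < t" "t \<le> b" for t
  proof (rule ccontr)
    assume "\<not> g t > 0"
    then have "t \<in> Z" using that a by (auto simp: Z_def)
    then show False using cSup_upper[OF _ \<open>bdd_above Z\<close>] that by (force simp: a_def)
  qed
  have "g b \<le> g a"
  proof (rule DERIV_nonpos_imp_decreasing_open[OF less_imp_le[OF a(2)]])
    show "continuous_on {a..b} g" using contg a by (auto intro: continuous_on_subset)
    fix t assume t: "a < t" "t < b"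
    \<comment> \<open>\<open>DB\<close> is a derivative within \<open>S\<close> only, so the chain
      rule is applied within an interval over which the whole curve lies in \<open>S\<close>. The
      interval is open, which yields an ordinary derivative of \<open>g\<close>.\<close>
    let ?U = "{a<..<b}"
    have inS: "(s, x s) \<in> S" if "s \<in> ?U" for s
      using that a pos[of s] by (auto simp: S g_def)
    have "(x has_derivative (\<lambda>h. h *\<^sub>R F (x t))) (at t within ?U)"
      using D[of t] t a unfolding has_vector_derivative_def
      by (auto intro: has_derivative_subset)
    then have "((\<lambda>s. (s, x s)) has_derivative (\<lambda>h. (h, h *\<^sub>R F (x t)))) (at t within ?U)"
      by (intro has_derivative_Pair has_derivative_ident)
    moreover have "((\<lambda>(t, x). B t x) has_derivative blinfun_apply (DB (t, x t)))
        (at (t, x t) within (\<lambda>s. (s, x s)) ` ?U)"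
      using DB[OF inS[of t]] inS t by (auto intro: has_derivative_subset)
    ultimately have "(g has_derivative (\<lambda>h. DB (t, x t) (h, h *\<^sub>R F (x t)))) (at t within ?U)"
      by (auto simp: g_def[abs_def] dest!: has_derivative_in_compose)
    moreover have "DB (t, x t) (h, h *\<^sub>R F (x t)) = DB (t, x t) (1, F (x t)) * h" for h
      using blinfun.scaleR_right[of "DB (t, x t)" h "(1, F (x t))"] by simp
    ultimately have "(g has_field_derivative DB (t, x t) (1, F (x t))) (at t)"
      using t by (simp add: has_field_derivative_def at_within_open[of t ?U])
    then show "\<exists>y. (g has_real_derivative y) (at t) \<and> y \<le> 0"
      using DB_le inS t by (metis greaterThanLessThan_iff)
  qed
  then show False using a gb by linarith
qed


section \<open>Bump functions supported in a tube around a curve\<close>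

text \<open>Squaring removes the kink of the positive part at 0 and leaves a cutoff of class
  C^1.\<close>

definition pos_sq :: "real \<Rightarrow> real" where
  "pos_sq u = (max 0 u)\<^sup>2"

lemma pos_sq_nonneg [simp]: "0 \<le> pos_sq u"
  by (simp add: pos_sq_def)

text \<open>For all signs of \<open>u\<close> and \<open>v\<close> the first-order error is at most
  \<open>(v - u)\<^sup>2\<close>, so the radius \<open>e\<close> serves for the tolerance
  \<open>e\<close>.\<close>

lemma DERIV_pos_sq: "(pos_sq has_field_derivative 2 * max 0 u) (at u)"
  unfolding has_field_derivative_def has_derivative_within_alt
proof (intro conjI allI impI bounded_linear_mult_right)
  fix e :: real assume "e > 0"
  have quad: "\<bar>pos_sq v - pos_sq u - 2 * max 0 u * (v - u)\<bar> \<le> (v - u)\<^sup>2" for v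
  proof (cases "u \<ge> 0"; cases "v \<ge> 0")
    assume "u \<ge> 0" "v \<ge> 0"
    then have "pos_sq v - pos_sq u - 2 * max 0 u * (v - u) = (v - u)\<^sup>2"
      by (simp add: pos_sq_def power2_eq_square algebra_simps)
    then show ?thesis by simp
  next
    assume uv: "u \<ge> 0" "\<not> v \<ge> 0"
    then have "u * v \<le> 0" by (simp add: mult_le_0_iff)
    moreover have "pos_sq v - pos_sq u - 2 * max 0 u * (v - u) = u * u - 2 * (u * v)"
      "(v - u)\<^sup>2 = u * u - 2 * (u * v) + v * v"
      using uv by (simp_all add: pos_sq_def power2_eq_square algebra_simps)
    ultimately show ?thesis using zero_le_square[of u] zero_le_square[of v] by linarith
  next
    assume uv: "\<not> u \<ge> 0" "v \<ge> 0"
    then have "v\<^sup>2 \<le> (v - u)\<^sup>2" by (intro power_mono) auto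
    then show ?thesis using uv by (simp add: pos_sq_def)
  qed (simp add: pos_sq_def)
  have "norm (pos_sq v - pos_sq u - 2 * max 0 u * (v - u)) \<le> e * norm (v - u)"
    if "norm (v - u) < e" for v
  proof -
    have "\<bar>pos_sq v - pos_sq u - 2 * max 0 u * (v - u)\<bar> \<le> \<bar>v - u\<bar> * \<bar>v - u\<bar>"
      using quad[of v] by (simp add: power2_eq_square)
    also have "\<dots> \<le> e * \<bar>v - u\<bar>" using that by (intro mult_right_mono) auto
    finally show ?thesis by simp
  qed
  then show "\<exists>d>0. \<forall>v\<in>UNIV. norm (v - u) < d \<longrightarrow>
      norm (pos_sq v - pos_sq u - 2 * max 0 u * (v - u)) \<le> e * norm (v - u)"
    using \<open>e > 0\<close> by blast
qed

lemma continuous_on_pos_sq [continuous_intros]: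
  "continuous_on S f \<Longrightarrow> continuous_on S (\<lambda>x. pos_sq (f x))"
  unfolding pos_sq_def by (intro continuous_intros)

text \<open>\<open>G\<close> is the gradient of \<open>\<beta>\<close> in \<open>(t, x)\<close>.
  Derivatives are taken within the half-space, hence one-sided in time at \<open>t = 0\<close>. The
  conditions are preserved by combinations with nonnegative coefficients, which allows bumps to be
  added up.\<close>

definition flow_bump ::
    "('a::euclidean_space \<Rightarrow> 'a) \<Rightarrow> 'a set \<Rightarrow> (real \<times> 'a \<Rightarrow> real) \<Rightarrow> (real \<times> 'a \<Rightarrow> real \<times> 'a) \<Rightarrow> bool" where
  "flow_bump F Xo \<beta> G \<longleftrightarrow>
    (\<forall>p\<in>{0..} \<times> UNIV. (\<beta> has_derivative (\<lambda>h. G p \<bullet> h)) (at p within {0..} \<times> UNIV)) \<and>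
    continuous_on ({0..} \<times> UNIV) G \<and>
    (\<forall>t\<ge>0. \<forall>x. 0 \<le> \<beta> (t, x) \<and> G (t, x) \<bullet> (1, F x) \<le> 0) \<and>
    (\<forall>t\<ge>0. \<forall>x\<in>Xo. \<beta> (t, x) = 0)"

text \<open>The curve \<open>\<gamma>\<close> may fail to be a solution; \<open>c\<close> measures
  the tolerated defect. By \<open>ineq\<close>, along solutions in the tube the quantity
  \<open>exp (M * t) * (norm (x - \<gamma> t))\<^sup>2\<close> decreases at a rate of at most
  \<open>c * exp (M * t)\<close>. A linear term in \<open>t\<close> compensates for this, so that
  their sum \<open>w\<close> is nondecreasing.\<close>

lemma flow_bump_tube:
  fixes F :: "'a::euclidean_space \<Rightarrow> 'a" and \<gamma> \<gamma>' :: "real \<Rightarrow> 'a"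
  assumes \<gamma>: "\<And>t. t \<ge> 0 \<Longrightarrow> (\<gamma> has_vector_derivative \<gamma>' t) (at t within {0..})"
    and \<gamma>': "continuous_on {0..} \<gamma>'"
    and pos: "\<rho> > 0" "T \<ge> 0" "M \<ge> 0" "c \<ge> 0"
    and ineq: "\<And>t x. 0 \<le> t \<Longrightarrow> t \<le> T \<Longrightarrow> norm (x - \<gamma> t) \<le> \<rho> \<Longrightarrow>
      - (M * (norm (x - \<gamma> t))\<^sup>2 + c) \<le> 2 * ((x - \<gamma> t) \<bullet> (F x - \<gamma>' t))"
    and avoid: "\<And>t x. 0 \<le> t \<Longrightarrow> t \<le> T \<Longrightarrow> norm (x - \<gamma> t) < \<rho> \<Longrightarrow> x \<notin> Xo"
  obtains \<beta> G where "flow_bump F Xo \<beta> G" "bounded (\<beta> ` ({0..} \<times> UNIV))" "bounded (G ` ({0..} \<times> UNIV))"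
    "\<And>t x. 0 \<le> t \<Longrightarrow> t < T \<Longrightarrow> exp (M * t) * (norm (x - \<gamma> t))\<^sup>2 + c * exp (M * T) * t < \<rho>\<^sup>2 \<Longrightarrow> \<beta> (t, x) > 0"
proof -
  let ?D = "{0..} \<times> UNIV :: (real \<times> 'a) set"
  \<comment> \<open>Up to time \<open>T\<close> this slope dominates
    \<open>c * exp (M * t)\<close>.\<close>
  define K where "K = c * exp (M * T)"
  define w where "w p = exp (M * fst p) * ((snd p - \<gamma> (fst p)) \<bullet> (snd p - \<gamma> (fst p))) + K * fst p" for p
  define W where "W p = (M * exp (M * fst p) * ((snd p - \<gamma> (fst p)) \<bullet> (snd p - \<gamma> (fst p)))
      - 2 * exp (M * fst p) * ((snd p - \<gamma> (fst p)) \<bullet> \<gamma>' (fst p)) + K,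
      (2 * exp (M * fst p)) *\<^sub>R (snd p - \<gamma> (fst p)))" for p
  \<comment> \<open>The first factor ends the bump at time \<open>T\<close>, the second where
    \<open>w\<close> reaches \<open>\<rho>\<^sup>2\<close>. Both are nonnegative and, inside the
    tube, nonincreasing along solutions, hence so is the product.\<close>
  define \<beta> where "\<beta> p = pos_sq (T - fst p) * pos_sq (\<rho>\<^sup>2 - w p)" for p
  define G where "G p = (- (2 * max 0 (T - fst p) * pos_sq (\<rho>\<^sup>2 - w p))) *\<^sub>R (1, 0)
      - (pos_sq (T - fst p) * (2 * max 0 (\<rho>\<^sup>2 - w p))) *\<^sub>R W p" for p
  have cont\<gamma>: "continuous_on {0..} \<gamma>"
    using \<gamma> by (intro continuous_on_vector_derivative) auto
  have c\<gamma>: "continuous_on ?D (\<lambda>p. \<gamma> (fst p))" "continuous_on ?D (\<lambda>p. \<gamma>' (fst p))"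
    by (rule continuous_on_compose2[OF cont\<gamma>] continuous_on_compose2[OF \<gamma>']; auto intro!: continuous_intros)+
  have D\<gamma>: "((\<lambda>p. \<gamma> (fst p)) has_derivative (\<lambda>h. fst h *\<^sub>R \<gamma>' (fst p))) (at p within ?D)"
    if "p \<in> ?D" for p
  proof (rule has_derivative_in_compose2[where t = "{0..}" and g = \<gamma> and f = fst and g' = "\<lambda>t h. h *\<^sub>R \<gamma>' t"])
    show "(\<gamma> has_derivative (\<lambda>h. h *\<^sub>R \<gamma>' t)) (at t within {0..})" if "t \<in> {0..}" for t
      using \<gamma> that by (simp add: has_vector_derivative_def)
    show "(fst has_derivative fst) (at p within ?D)"
      by (rule has_derivative_fst[OF has_derivative_ident])
  qed (use that in auto)
  have Dw: "(w has_derivative (\<lambda>h. W p \<bullet> h)) (at p within ?D)" if "p \<in> ?D" for p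
  proof -
    define z where "z p = snd p - \<gamma> (fst p)" for p
    have "(z has_derivative (\<lambda>h. snd h - fst h *\<^sub>R \<gamma>' (fst p))) (at p within ?D)"
      unfolding z_def[abs_def]
      by (intro has_derivative_diff D\<gamma>[OF that] has_derivative_snd has_derivative_ident)
    from has_derivative_inner[OF this this]
    have "((\<lambda>p. z p \<bullet> z p) has_derivative
        (\<lambda>h. 2 * (z p \<bullet> (snd h - fst h *\<^sub>R \<gamma>' (fst p))))) (at p within ?D)"
      by (simp add: inner_commute)
    moreover have "((\<lambda>p. exp (M * fst p)) has_derivative (\<lambda>h. exp (M * fst p) * (M * fst h))) (at p within ?D)"
      by (auto intro!: derivative_eq_intros)
    moreover have "((\<lambda>p. K * fst p) has_derivative (\<lambda>h. K * fst h)) (at p within ?D)"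
      by (auto intro!: derivative_eq_intros)
    ultimately have "((\<lambda>p. exp (M * fst p) * (z p \<bullet> z p) + K * fst p) has_derivative
        (\<lambda>h. exp (M * fst p) * (2 * (z p \<bullet> (snd h - fst h *\<^sub>R \<gamma>' (fst p))))
          + exp (M * fst p) * (M * fst h) * (z p \<bullet> z p) + K * fst h)) (at p within ?D)"
      by (intro has_derivative_add has_derivative_mult)
    moreover have "(\<lambda>h. exp (M * fst p) * (2 * (z p \<bullet> (snd h - fst h *\<^sub>R \<gamma>' (fst p))))
          + exp (M * fst p) * (M * fst h) * (z p \<bullet> z p) + K * fst h) = (\<lambda>h. W p \<bullet> h)"
      by (simp add: W_def z_def[symmetric] fun_eq_iff inner_prod_def inner_diff_right algebra_simps)
    ultimately show ?thesis
      by (simp add: w_def[abs_def] z_def)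
  qed
  have D\<beta>: "(\<beta> has_derivative (\<lambda>h. G p \<bullet> h)) (at p within ?D)" if "p \<in> ?D" for p
  proof -
    note pos_sq_compose = has_derivative_compose[OF _ DERIV_pos_sq[unfolded has_field_derivative_def]]
    have "((\<lambda>p. \<rho>\<^sup>2 - w p) has_derivative (\<lambda>h. - (W p \<bullet> h))) (at p within ?D)"
      using has_derivative_diff[OF has_derivative_const Dw[OF that]] by simp
    note 1 = pos_sq_compose[OF this]
    have "((\<lambda>p. T - fst p) has_derivative (\<lambda>h. - fst h)) (at p within ?D)"
      by (auto intro!: derivative_eq_intros)
    note 2 = pos_sq_compose[OF this]
    have "(\<lambda>h. pos_sq (T - fst p) * (2 * max 0 (\<rho>\<^sup>2 - w p) * - (W p \<bullet> h)) +
        2 * max 0 (T - fst p) * - fst h * pos_sq (\<rho>\<^sup>2 - w p)) = (\<lambda>h. G p \<bullet> h)"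
      by (simp add: G_def fun_eq_iff inner_prod_def inner_diff_left algebra_simps)
    then show ?thesis
      unfolding \<beta>_def[abs_def] using has_derivative_mult[OF 2 1] by simp
  qed
  have cw: "continuous_on ?D w"
    unfolding w_def[abs_def] by (intro continuous_intros c\<gamma>)
  have cG: "continuous_on ?D G"
    unfolding G_def[abs_def] W_def[abs_def] by (intro continuous_intros c\<gamma> cw)
  have c\<beta>: "continuous_on ?D \<beta>"
    unfolding \<beta>_def[abs_def] by (intro continuous_intros cw)
  \<comment> \<open>Since \<open>exp (M * t) \<ge> 1\<close> and \<open>K * t \<ge> 0\<close>, the
    second cutoff confines the bump to the tube, where \<open>ineq\<close> and \<open>avoid\<close>
    are available.\<close>
  have near: "norm (x - \<gamma> t) < \<rho>" if "0 \<le> t" "w (t, x) < \<rho>\<^sup>2" for t x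
  proof -
    have "(norm (x - \<gamma> t))\<^sup>2 \<le> exp (M * t) * (norm (x - \<gamma> t))\<^sup>2"
      using that pos by (simp add: mult_le_cancel_right1)
    also have "\<dots> \<le> w (t, x)"
      using that pos by (simp add: w_def K_def power2_norm_eq_inner)
    finally show ?thesis
      using that pos by (meson le_less_trans less_imp_le power_less_imp_less_base)
  qed
  obtain C where C: "\<And>t. t \<in> {0..T} \<Longrightarrow> norm (\<gamma> t) \<le> C"
  proof -
    have "compact (\<gamma> ` {0..T})"
      using cont\<gamma> by (intro compact_continuous_image) (auto intro: continuous_on_subset)
    then show thesis using that by (metis bounded_iff compact_imp_bounded imageI)
  qed
  \<comment> \<open>A compact set outside which \<open>\<beta>\<close> and \<open>G\<close> vanish;
    continuity on it gives the global bounds.\<close>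
  let ?Q = "{0..T} \<times> cball 0 (C + \<rho>) :: (real \<times> 'a) set"
  have supp: "\<beta> p = 0 \<and> G p = 0" if p: "p \<in> ?D - ?Q" for p
  proof -
    obtain t x where tx: "p = (t, x)" by force
    then have t: "t \<ge> 0" using p by auto
    show ?thesis
    proof (cases "t < T \<and> w (t, x) < \<rho>\<^sup>2")
      case True
      then have "norm (x - \<gamma> t) < \<rho>" using near t by blast
      moreover have "norm (\<gamma> t) \<le> C" using C True t by auto
      ultimately have "norm x \<le> C + \<rho>" using norm_triangle_ineq2[of x "\<gamma> t"] by linarith
      then show ?thesis using p tx True t by auto
    next
      case False
      then show ?thesis by (auto simp: tx \<beta>_def G_def pos_sq_def zero_prod_def)
    qed
  qed
  have bdd: "bounded (f ` ?D)" if "continuous_on ?D f" "\<And>p. p \<in> ?D - ?Q \<Longrightarrow> f p = 0"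
    for f :: "real \<times> 'a \<Rightarrow> 'b::real_normed_vector"
  proof (rule bounded_subset)
    have "compact (f ` ?Q)"
      using that(1) by (intro compact_continuous_image compact_Times) (auto intro: continuous_on_subset)
    then show "bounded (insert 0 (f ` ?Q))" by (simp add: compact_imp_bounded)
    show "f ` ?D \<subseteq> insert 0 (f ` ?Q)" using that(2) by blast
  qed
  have "G (t, x) \<bullet> (1, F x) \<le> 0" if t: "t \<ge> 0" for t x
  proof (cases "t < T \<and> w (t, x) < \<rho>\<^sup>2")
    case True
    then have "norm (x - \<gamma> t) \<le> \<rho>" using near[OF t] by force
    then have *: "- (M * (norm (x - \<gamma> t))\<^sup>2 + c) \<le> 2 * ((x - \<gamma> t) \<bullet> (F x - \<gamma>' t))"
      using ineq[of t x] True t by simp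
    have "exp (M * t) * c \<le> K"
      using True pos by (simp add: K_def mult.commute mult_left_mono)
    \<comment> \<open>This is the derivative of \<open>w\<close> along \<open>F\<close>, split into
      a part that is nonnegative by \<open>ineq\<close> and the surplus of \<open>K\<close>.\<close>
    then have "0 \<le> exp (M * t) * (M * (norm (x - \<gamma> t))\<^sup>2 + c + 2 * ((x - \<gamma> t) \<bullet> (F x - \<gamma>' t))) + (K - exp (M * t) * c)"
      using * by (intro add_nonneg_nonneg[OF mult_nonneg_nonneg]) auto
    also have "\<dots> = W (t, x) \<bullet> (1, F x)"
      by (simp add: W_def inner_prod_def power2_norm_eq_inner inner_simps algebra_simps)
    finally have "0 \<le> W (t, x) \<bullet> (1, F x)" .
    moreover have "G (t, x) \<bullet> (1, F x) = - (2 * max 0 (T - t) * pos_sq (\<rho>\<^sup>2 - w (t, x)))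
        - (pos_sq (T - t) * (2 * max 0 (\<rho>\<^sup>2 - w (t, x)))) * (W (t, x) \<bullet> (1, F x))"
      by (simp add: G_def inner_diff_left)
    ultimately show ?thesis
      by (smt (verit) mult_nonneg_nonneg pos_sq_nonneg)
  next
    case False
    then show ?thesis by (auto simp: G_def pos_sq_def)
  qed
  moreover have "\<beta> (t, x) = 0" if "t \<ge> 0" "x \<in> Xo" for t x
    using near[of t x] avoid[of t x] that by (force simp: \<beta>_def pos_sq_def)
  ultimately have "flow_bump F Xo \<beta> G"
    unfolding flow_bump_def
    using D\<beta> cG by (auto simp: \<beta>_def)
  moreover have "\<beta> (t, x) > 0" if "0 \<le> t" "t < T"
      "exp (M * t) * (norm (x - \<gamma> t))\<^sup>2 + c * exp (M * T) * t < \<rho>\<^sup>2" for t x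
    using that by (simp add: \<beta>_def w_def K_def pos_sq_def power2_norm_eq_inner)
  ultimately show thesis using that bdd[OF c\<beta>] bdd[OF cG] supp by blast
qed


section \<open>The bump at a point of the unsafe set\<close>

lemma has_vector_derivative_affine_compose:
  fixes z :: "real \<Rightarrow> 'a::real_normed_vector"
  assumes "(z has_vector_derivative v) (at (a + k * s) within S')" "(\<lambda>s. a + k * s) ` S \<subseteq> S'"
  shows "((\<lambda>s. z (a + k * s)) has_vector_derivative k *\<^sub>R v) (at s within S)"
proof -
  have "((\<lambda>s. a + k * s) has_vector_derivative k) (at s within S)"
    by (auto intro!: derivative_eq_intros)
  from vector_diff_chain_within[OF this has_vector_derivative_within_subset[OF assms]]
  show ?thesis by (simp add: o_def)
qed

text \<open>If the backward solution from \<open>x0\<close> met \<open>Xo\<close>, its time reversal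
  would lead from \<open>Xo\<close> to \<open>x0\<close>, against safety. Compactness of its arc
  over \<open>{0..t0}\<close> then gives a positive distance \<open>\<delta>\<close> from
  \<open>Xo\<close>, and the bound of \<open>F'\<close> on a ball gives a Lipschitz constant. The
  parameters for \<open>flow_bump_tube\<close> are built from these.\<close>

lemma safe_imp_flow_bump:
  fixes F :: "'a::euclidean_space \<Rightarrow> 'a" and F' :: "'a \<Rightarrow> 'a \<Rightarrow>\<^sub>L 'a"
  assumes F_deriv: "\<And>x. (F has_derivative blinfun_apply (F' x)) (at x)"
    and F'_cont: "continuous_on UNIV F'"
    and bc: "backward_complete F" and Xo: "closed Xo" and safe: "safe F Xo Xu"
    and x0: "x0 \<in> Xu" and t0: "t0 \<ge> 0"
  obtains \<beta> G where "flow_bump F Xo \<beta> G" "bounded (\<beta> ` ({0..} \<times> UNIV))" "bounded (G ` ({0..} \<times> UNIV))"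
    "\<beta> (t0, x0) > 0"
proof -
  have contF: "continuous_on UNIV F"
    using F_deriv by (intro has_derivative_continuous_on) (auto intro: has_derivative_at_withinI)
  then have contF_minus: "continuous_on UNIV (\<lambda>x. - F x)" by (intro continuous_intros)
  obtain z where sol: "ode_solution (\<lambda>x. - F x) {0..} z" and z0: "z 0 = x0"
    using forward_complete_global_solution[OF contF_minus] bc unfolding backward_complete_def by blast
  have Dz: "(z has_vector_derivative - F (z t)) (at t within {0..d})" if "0 \<le> t" "t \<le> d" for t d
    using sol that unfolding ode_solution_iff[OF contF_minus] by auto
  have Drev: "((\<lambda>r. z (a - r)) has_vector_derivative F (z (a - s))) (at s within {0..d})"
    if "0 \<le> s" "s \<le> d" "d \<le> a" for a s d
  proof -
    have "(\<lambda>s. a + (- 1) * s) ` {0..d} \<subseteq> {0..a}" using that by auto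
    from has_vector_derivative_affine_compose[OF Dz[of "a + (- 1) * s" a] this]
    show ?thesis using that by simp
  qed
  have avoid: "z r \<notin> Xo" if r: "r \<ge> 0" for r
  proof
    assume "z r \<in> Xo"
    have "ode_solution F {0..r} (\<lambda>s. z (r - s))"
      unfolding ode_solution_iff[OF contF] using r Drev by auto
    then show False
      using safe[unfolded safe_def, rule_format, of "{0..r}" "\<lambda>s. z (r - s)" r] \<open>z r \<in> Xo\<close> x0 z0 r
      by auto
  qed
  have contz: "continuous_on {0..d} z" for d
    using Dz by (intro continuous_on_vector_derivative[of _ z "\<lambda>t. - F (z t)"]) auto
  then have cpt: "compact (z ` {0..t0})" by (intro compact_continuous_image) auto
  obtain \<delta> where "\<delta> > 0" and \<delta>: "\<And>s y. s \<in> {0..t0} \<Longrightarrow> y \<in> Xo \<Longrightarrow> \<delta> \<le> dist (z s) y"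
    using separate_compact_closed[OF cpt Xo] avoid by fastforce
  obtain C where C: "\<And>s. s \<in> {0..t0} \<Longrightarrow> norm (z s) \<le> C"
    using compact_imp_bounded[OF cpt] unfolding bounded_iff by blast
  \<comment> \<open>The arc lies in the ball of radius \<open>C\<close>; its continuation past
    \<open>t0\<close> and the tube radius each add at most 1.\<close>
  have "compact (F' ` cball 0 (C + 2))"
    using F'_cont by (intro compact_continuous_image) (auto intro: continuous_on_subset)
  then obtain L0 where L0: "\<And>x. x \<in> cball 0 (C + 2) \<Longrightarrow> norm (F' x) \<le> L0"
    by (metis bounded_iff compact_imp_bounded imageI)
  define L where "L = max 0 L0"
  have lip: "norm (F x - F y) \<le> L * norm (x - y)" if "norm x \<le> C + 2" "norm y \<le> C + 2" for x y
  proof (rule differentiable_bound[of "cball 0 (C + 2)" F F'])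
    show "(F has_derivative blinfun_apply (F' x)) (at x within cball 0 (C + 2))" for x
      by (rule has_derivative_at_withinI[OF F_deriv])
    show "onorm (blinfun_apply (F' x)) \<le> L" if "x \<in> cball 0 (C + 2)" for x
      using L0[OF that] by (simp add: L_def norm_blinfun.rep_eq[symmetric])
  qed (use that in auto)
  have "L \<ge> 0" by (simp add: L_def)
  \<comment> \<open>\<open>2 * L\<close> comes from the Lipschitz bound, and 1 from splitting the
    product of displacement and defect by
    \<open>2 * a * b \<le> a\<^sup>2 + b\<^sup>2\<close>.\<close>
  define M where "M = 2 * L + 1"
  \<comment> \<open>Half of \<open>\<delta>\<close> is left for the drift of \<open>\<gamma>\<close>
    away from \<open>x0\<close> after \<open>t0\<close>.\<close>
  define \<rho> where "\<rho> = min 1 (\<delta> / 2)"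
  \<comment> \<open>At \<open>(t0, x0)\<close> the tube function equals
    \<open>c * exp (M * T) * t0\<close>, which must stay below \<open>\<rho>\<^sup>2\<close>. As
    \<open>\<epsilon>\<close>, and hence \<open>T\<close>, will depend on \<open>c\<close>, the
    bound \<open>Q\<close> uses only \<open>T \<le> t0 + 1\<close>; then \<open>c * Q\<close> is
    half of \<open>\<rho>\<^sup>2\<close>.\<close>
  define Q where "Q = exp (M * (t0 + 1)) * (t0 + 1)"
  define c where "c = \<rho>\<^sup>2 / (2 * Q)"
  define V where "V = norm (F x0)"
  \<comment> \<open>The three bounds give \<open>T \<le> t0 + 1\<close>, a drift of at most
    \<open>\<rho>\<close>, and the required smallness of the defect. The added ones keep the
    denominators positive.\<close>
  define \<epsilon> where "\<epsilon> = min 1 (min (\<rho> / (V + 1)) (sqrt c / (L * V + 1)))"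
  define T where "T = t0 + \<epsilon>"
  have \<rho>: "0 < \<rho>" "\<rho> \<le> 1" "2 * \<rho> \<le> \<delta>" using \<open>\<delta> > 0\<close> by (auto simp: \<rho>_def)
  have "Q > 0" using t0 by (simp add: Q_def)
  then have "c > 0" using \<rho> by (simp add: c_def)
  have "V \<ge> 0" by (simp add: V_def)
  have LV: "L * V + 1 > 0" using \<open>L \<ge> 0\<close> \<open>V \<ge> 0\<close> by (simp add: add_nonneg_pos)
  have \<epsilon>: "0 < \<epsilon>" "\<epsilon> \<le> 1"
    using \<rho> \<open>c > 0\<close> \<open>V \<ge> 0\<close> LV by (auto simp: \<epsilon>_def)
  have \<epsilon>V: "\<epsilon> * V \<le> \<rho>"
  proof -
    have "\<epsilon> * (V + 1) \<le> \<rho>"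
      using \<open>V \<ge> 0\<close> by (simp add: \<epsilon>_def pos_le_divide_eq[symmetric])
    then show ?thesis using \<epsilon> by (simp add: algebra_simps)
  qed
  have \<epsilon>LV: "L * (\<epsilon> * V) \<le> sqrt c"
  proof -
    have "\<epsilon> * (L * V + 1) \<le> sqrt c"
      using LV by (simp add: \<epsilon>_def pos_le_divide_eq[symmetric])
    then show ?thesis using \<epsilon> by (simp add: algebra_simps)
  qed
  \<comment> \<open>The bump must stay positive slightly beyond \<open>t0\<close>, but the system need not be forward complete.
    So \<open>\<gamma>\<close> is continued by its tangent; \<open>\<epsilon>\<close> is chosen to keep the defect \<open>F (\<gamma> t) - \<gamma>' t\<close> below \<open>sqrt c\<close>,
    and the term \<open>c * exp (M * T) * t\<close> in the tube function absorbs it.\<close>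
  define \<gamma> where "\<gamma> t = (if t \<in> {0..t0} then z (t0 - t) else x0 + (t - t0) *\<^sub>R F x0)" for t
  define \<gamma>' where "\<gamma>' t = (if t \<in> {0..t0} then F (z (t0 - t)) else F x0)" for t
  have D\<gamma>: "(\<gamma> has_vector_derivative \<gamma>' t) (at t within {0..})" if "t \<ge> 0" for t
    unfolding \<gamma>_def[abs_def] \<gamma>'_def
  \<comment> \<open>The two pieces meet only at \<open>t0\<close>, with common value
    \<open>x0\<close> and common derivative \<open>F x0\<close>.\<close>
  proof (rule has_vector_derivative_If_within_closures[where T = "{t0..}"])
    show "((\<lambda>t. z (t0 - t)) has_vector_derivative F (z (t0 - t)))
        (at t within {0..t0} \<union> closure {0..t0} \<inter> closure {t0..})"
      if "t \<in> {0..t0} \<union> closure {0..t0} \<inter> closure {t0..}"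
      using Drev[of t t0 t0] that t0 by (simp add: insert_absorb)
    show "((\<lambda>t. x0 + (t - t0) *\<^sub>R F x0) has_vector_derivative F x0)
        (at t within {t0..} \<union> closure {0..t0} \<inter> closure {t0..})"
      by (auto intro!: derivative_eq_intros)
  qed (use that t0 z0 in auto)
  have cont\<gamma>': "continuous_on {0..} \<gamma>'"
  proof -
    \<comment> \<open>Clamping the argument at 0 gives a single formula for both pieces of
      \<open>\<gamma>'\<close>, because \<open>z 0 = x0\<close>.\<close>
    have "continuous_on {0..} (\<lambda>t. z (max 0 (t0 - t)))"
      by (rule continuous_on_compose2[OF contz[of t0]]) (auto intro!: continuous_intros simp: t0)
    then have "continuous_on {0..} (\<lambda>t. F (z (max 0 (t0 - t))))"
      by (rule continuous_on_compose2[OF contF]) auto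
    then show ?thesis
      by (rule continuous_on_eq) (auto simp: \<gamma>'_def z0 max_def)
  qed
  have late: "norm (\<gamma> t - x0) \<le> \<epsilon> * V" if "t0 < t" "t \<le> T" for t
    using that \<open>V \<ge> 0\<close> by (auto simp: \<gamma>_def T_def V_def intro!: mult_right_mono)
  have \<gamma>_bound: "norm (\<gamma> t) \<le> C + 1" if "0 \<le> t" "t \<le> T" for t
  proof (cases "t \<le> t0")
    case True
    then show ?thesis using C[of "t0 - t"] that by (simp add: \<gamma>_def)
  next
    case False
    then have "norm (\<gamma> t - x0) \<le> 1" using late[of t] that \<epsilon>V \<rho> by auto
    then show ?thesis using C[of 0] t0 z0 norm_triangle_ineq2[of "\<gamma> t" x0] by auto
  qed
  have residual: "norm (F (\<gamma> t) - \<gamma>' t) \<le> sqrt c" if t: "0 \<le> t" "t \<le> T" for t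
  proof (cases "t \<le> t0")
    case True
    then show ?thesis using t \<open>c > 0\<close> by (simp add: \<gamma>_def \<gamma>'_def)
  next
    case False
    have "norm (F (\<gamma> t) - F x0) \<le> L * norm (\<gamma> t - x0)"
      using \<gamma>_bound[OF t] C[of 0] t0 z0 by (intro lip) auto
    also have "\<dots> \<le> L * (\<epsilon> * V)"
      using late[of t] False t \<open>L \<ge> 0\<close> by (intro mult_left_mono) auto
    finally show ?thesis using \<epsilon>LV False by (simp add: \<gamma>'_def)
  qed
  show thesis
  proof (rule flow_bump_tube[OF D\<gamma> cont\<gamma>' \<rho>(1), of T M c F Xo])
    fix t x assume t: "0 \<le> t" "t \<le> T"
    { assume x: "norm (x - \<gamma> t) \<le> \<rho>"
      let ?d = "x - \<gamma> t" and ?e = "F (\<gamma> t) - \<gamma>' t"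
      have "norm x \<le> C + 2"
        using x \<rho> \<gamma>_bound[OF t] norm_triangle_ineq2[of x "\<gamma> t"] by linarith
      then have "norm (F x - F (\<gamma> t)) \<le> L * norm ?d"
        using \<gamma>_bound[OF t] by (intro lip) auto
      then have "norm ?d * norm (F x - F (\<gamma> t)) \<le> norm ?d * (L * norm ?d)"
        by (rule mult_left_mono) simp
      then have 1: "- (L * (norm ?d)\<^sup>2) \<le> ?d \<bullet> (F x - F (\<gamma> t))"
        using Cauchy_Schwarz_ineq2[of ?d "F x - F (\<gamma> t)"] by (simp add: power2_eq_square algebra_simps)
      have "(norm ?e)\<^sup>2 \<le> c"
        using power_mono[OF residual[OF t], of 2] \<open>c > 0\<close> by simp
      moreover have "2 * (norm ?d * norm ?e) \<le> (norm ?d)\<^sup>2 + (norm ?e)\<^sup>2"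
        using sum_squares_bound[of "norm ?d" "norm ?e"] by simp
      ultimately have 2: "- ((norm ?d)\<^sup>2 + c) \<le> 2 * (?d \<bullet> ?e)"
        using Cauchy_Schwarz_ineq2[of ?d ?e] by linarith
      have "2 * (?d \<bullet> (F x - \<gamma>' t)) = 2 * (?d \<bullet> (F x - F (\<gamma> t))) + 2 * (?d \<bullet> ?e)"
        by (simp add: inner_diff_right)
      with 1 2 show "- (M * (norm ?d)\<^sup>2 + c) \<le> 2 * (?d \<bullet> (F x - \<gamma>' t))"
        by (simp add: M_def algebra_simps)
    }
    assume x: "norm (x - \<gamma> t) < \<rho>"
    show "x \<notin> Xo"
    proof (cases "t \<le> t0")
      case True
      then show ?thesis
        using \<delta>[of "t0 - t" x] x t \<rho> by (auto simp: \<gamma>_def dist_norm norm_minus_commute)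
    next
      case False
      then have "norm (x - x0) < \<delta>"
        using late[of t] t \<epsilon>V x \<rho> norm_triangle_ineq[of "x - \<gamma> t" "\<gamma> t - x0"] by simp
      then show ?thesis
        using \<delta>[of 0 x] t0 z0 by (auto simp: dist_norm norm_minus_commute)
    qed
  next
    fix \<beta> G
    assume bump: "flow_bump F Xo \<beta> G" "bounded (\<beta> ` ({0..} \<times> UNIV))" "bounded (G ` ({0..} \<times> UNIV))"
      and pos: "\<And>t x. 0 \<le> t \<Longrightarrow> t < T \<Longrightarrow>
        exp (M * t) * (norm (x - \<gamma> t))\<^sup>2 + c * exp (M * T) * t < \<rho>\<^sup>2 \<Longrightarrow> \<beta> (t, x) > 0"
    have "exp (M * T) * t0 \<le> Q"
      unfolding Q_def T_def using \<epsilon> t0 \<open>L \<ge> 0\<close>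
      by (intro mult_mono) (auto simp: M_def intro!: mult_left_mono)
    then have "c * (exp (M * T) * t0) \<le> c * Q"
      using \<open>c > 0\<close> by (intro mult_left_mono) auto
    also have "\<dots> < \<rho>\<^sup>2" using \<open>Q > 0\<close> \<rho> by (simp add: c_def)
    finally have "\<beta> (t0, x0) > 0"
      using pos[of t0 x0] t0 \<epsilon> z0 by (simp add: \<gamma>_def T_def algebra_simps)
    with bump show thesis using that by blast
  qed (use t0 \<epsilon> \<open>L \<ge> 0\<close> \<open>c > 0\<close> in \<open>auto simp: T_def M_def\<close>)
qed


section \<open>Countable sums of bumps and a Lindelof covering\<close>

text \<open>Weights that shrink faster than the bounds of the bumps and of their gradients make the
  series of gradients converge uniformly, so the sum may be differentiated term by term. Nonnegative
  terms cannot cancel, so it is positive wherever some bump is.\<close>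

lemma flow_bump_suminf:
  fixes F :: "'a::euclidean_space \<Rightarrow> 'a"
  assumes bump: "\<And>n::nat. flow_bump F Xo (\<beta> n) (G n)"
    and bdd_\<beta>: "\<And>n. bounded (\<beta> n ` ({0..} \<times> UNIV))"
    and bdd_G: "\<And>n. bounded (G n ` ({0..} \<times> UNIV))"
  obtains \<beta>\<^sub>0 G\<^sub>0 where "flow_bump F Xo \<beta>\<^sub>0 G\<^sub>0"
    "\<And>n p. p \<in> {0..} \<times> UNIV \<Longrightarrow> \<beta> n p > 0 \<Longrightarrow> \<beta>\<^sub>0 p > 0"
proof -
  let ?D = "{0..} \<times> UNIV :: (real \<times> 'a) set"
  have "\<exists>A\<ge>0. \<forall>p\<in>?D. norm (\<beta> n p) \<le> A \<and> norm (G n p) \<le> A" for n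
  proof -
    obtain A1 A2 where "\<And>p. p \<in> ?D \<Longrightarrow> norm (\<beta> n p) \<le> A1" "\<And>p. p \<in> ?D \<Longrightarrow> norm (G n p) \<le> A2"
      using bdd_\<beta>[of n] bdd_G[of n] unfolding bounded_iff by (metis imageI)
    then show ?thesis by (intro exI[of _ "max 0 (max A1 A2)"]) (simp add: le_max_iff_disj)
  qed
  then obtain A where A: "\<And>n. A n \<ge> 0" "\<And>n p. p \<in> ?D \<Longrightarrow> norm (\<beta> n p) \<le> A n"
    "\<And>n p. p \<in> ?D \<Longrightarrow> norm (G n p) \<le> A n"
    by metis
  \<comment> \<open>\<open>A n\<close> bounds both the bump and its gradient, so each weighted term
    has norm at most \<open>(1/2) ^ n\<close>.\<close>
  define a where "a n = (1/2) ^ n / (1 + A n)" for n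
  have a: "a n > 0" for n using A(1)[of n] by (simp add: a_def add_pos_nonneg)
  have aA: "a n * y \<le> (1/2) ^ n" if "y \<le> A n" for n y
  proof -
    have "a n * y \<le> a n * (1 + A n)" using a[of n] that by (intro mult_left_mono) auto
    also have "\<dots> = (1/2) ^ n" using A(1)[of n] by (simp add: a_def)
    finally show ?thesis .
  qed
  have geo: "summable (\<lambda>n. (1/2) ^ n :: real)" by (simp add: summable_geometric)
  have bound_\<beta>: "norm (a n * \<beta> n p) \<le> (1/2) ^ n" and bound_G: "norm (a n *\<^sub>R G n p) \<le> (1/2) ^ n"
    if "p \<in> ?D" for n p
    using aA[OF A(2)[OF that]] aA[OF A(3)[OF that]] a[of n] by (simp_all add: abs_mult)
  have sum_\<beta>: "summable (\<lambda>n. a n * \<beta> n p)" and sum_G: "summable (\<lambda>n. a n *\<^sub>R G n p)" if "p \<in> ?D" for p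
    using bound_\<beta>[OF that] bound_G[OF that] by (auto intro: summable_comparison_test'[OF geo])
  define G\<^sub>0 where "G\<^sub>0 p = (\<Sum>n. a n *\<^sub>R G n p)" for p
  have unif: "uniform_limit ?D (\<lambda>n p. \<Sum>i<n. a i *\<^sub>R G i p) G\<^sub>0 sequentially"
    unfolding G\<^sub>0_def using bound_G geo by (rule Weierstrass_m_test)
  have contG: "continuous_on ?D G\<^sub>0"
  proof (rule uniform_limit_theorem[OF _ unif])
    show "\<forall>\<^sub>F n in sequentially. continuous_on ?D (\<lambda>p. \<Sum>i<n. a i *\<^sub>R G i p)"
      using bump unfolding flow_bump_def by (intro always_eventually allI continuous_intros) auto
  qed simp
  have "\<exists>g. \<forall>p\<in>?D. (\<lambda>n. a n * \<beta> n p) sums g p \<and> (g has_derivative (\<lambda>h. G\<^sub>0 p \<bullet> h)) (at p within ?D)"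
  proof (rule has_derivative_series)
    show "convex ?D" by (intro convex_Times) auto
    show "((\<lambda>p. a n * \<beta> n p) has_derivative (\<lambda>h. (a n *\<^sub>R G n p) \<bullet> h)) (at p within ?D)" if "p \<in> ?D" for n p
    proof -
      have "(\<beta> n has_derivative (\<lambda>h. G n p \<bullet> h)) (at p within ?D)"
        using bump[of n] that unfolding flow_bump_def by blast
      from has_derivative_mult_right[OF this, of "a n"] show ?thesis by simp
    qed
    show "\<forall>\<^sub>F n in sequentially. \<forall>p\<in>?D. \<forall>h. norm ((\<Sum>i<n. (a i *\<^sub>R G i p) \<bullet> h) - G\<^sub>0 p \<bullet> h) \<le> e * norm h"
      if "e > 0" for e
    proof -
      have "\<forall>\<^sub>F n in sequentially. \<forall>p\<in>?D. dist (\<Sum>i<n. a i *\<^sub>R G i p) (G\<^sub>0 p) < e"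
        using unif that by (rule uniform_limitD)
      then show ?thesis
      proof (rule eventually_mono, intro ballI allI)
        fix n p h
        assume *: "\<forall>p\<in>?D. dist (\<Sum>i<n. a i *\<^sub>R G i p) (G\<^sub>0 p) < e" and "p \<in> ?D"
        have "(\<Sum>i<n. (a i *\<^sub>R G i p) \<bullet> h) - G\<^sub>0 p \<bullet> h = ((\<Sum>i<n. a i *\<^sub>R G i p) - G\<^sub>0 p) \<bullet> h"
          by (simp only: inner_diff_left inner_sum_left)
        also have "norm \<dots> \<le> norm ((\<Sum>i<n. a i *\<^sub>R G i p) - G\<^sub>0 p) * norm h"
          using Cauchy_Schwarz_ineq2 by simp
        also have "\<dots> \<le> e * norm h"
          using bspec[OF * \<open>p \<in> ?D\<close>] by (intro mult_right_mono) (auto simp: dist_norm)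
        finally show "norm ((\<Sum>i<n. (a i *\<^sub>R G i p) \<bullet> h) - G\<^sub>0 p \<bullet> h) \<le> e * norm h" .
      qed
    qed
    \<comment> \<open>On a convex domain uniform convergence of the derivatives and convergence at a
      single point suffice; the origin is taken.\<close>
    show "(0, 0) \<in> ?D" by simp
    show "(\<lambda>n. a n * \<beta> n (0, 0)) sums (\<Sum>n. a n * \<beta> n (0, 0))"
      using sum_\<beta>[of "(0, 0)"] by (intro summable_sums) auto
  qed
  then obtain \<beta>\<^sub>0 where sums: "\<And>p. p \<in> ?D \<Longrightarrow> (\<lambda>n. a n * \<beta> n p) sums \<beta>\<^sub>0 p"
    and deriv: "\<And>p. p \<in> ?D \<Longrightarrow> (\<beta>\<^sub>0 has_derivative (\<lambda>h. G\<^sub>0 p \<bullet> h)) (at p within ?D)"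
    by blast
  have nonneg: "0 \<le> a n * \<beta> n p" if "p \<in> ?D" for n p
    using bump[of n] a[of n] that unfolding flow_bump_def by (cases p) auto
  have \<beta>_nonneg: "0 \<le> \<beta>\<^sub>0 p" if "p \<in> ?D" for p
    using sums_le[OF _ sums_zero sums[OF that]] nonneg[OF that] by blast
  have "G\<^sub>0 (t, x) \<bullet> (1, F x) \<le> 0" if "t \<ge> 0" for t x
  proof -
    have D: "(t, x) \<in> ?D" using that by simp
    have 1: "(\<lambda>n. (a n *\<^sub>R G n (t, x)) \<bullet> (1, F x)) sums (G\<^sub>0 (t, x) \<bullet> (1, F x))"
      unfolding G\<^sub>0_def
      by (rule bounded_linear.sums[OF bounded_linear_inner_left summable_sums[OF sum_G[OF D]]])
    have 2: "(a n *\<^sub>R G n (t, x)) \<bullet> (1, F x) \<le> 0" for n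
      using bump[of n] a[of n] that unfolding flow_bump_def
      by (auto simp: mult_le_0_iff order_less_le)
    show ?thesis by (rule sums_le[OF 2 1 sums_zero])
  qed
  moreover have "\<beta>\<^sub>0 (t, x) = 0" if "t \<ge> 0" "x \<in> Xo" for t x
  proof -
    have "\<beta> n (t, x) = 0" for n using bump[of n] that unfolding flow_bump_def by blast
    then have "(\<lambda>n. a n * \<beta> n (t, x)) sums 0" by simp
    then show ?thesis using sums_unique2[OF sums[of "(t, x)"]] that by simp
  qed
  ultimately have "flow_bump F Xo \<beta>\<^sub>0 G\<^sub>0"
    unfolding flow_bump_def using deriv contG \<beta>_nonneg by auto
  moreover have "\<beta>\<^sub>0 p > 0" if "p \<in> ?D" "\<beta> n p > 0" for n p
  proof -
    have "0 < a n * \<beta> n p" using a[of n] that by simp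
    then have "0 < (\<Sum>n. a n * \<beta> n p)"
      using suminf_pos2[OF sum_\<beta>[OF that(1)] nonneg[OF that(1)]] by blast
    then show ?thesis using sums[OF that(1)] by (simp add: sums_iff)
  qed
  ultimately show thesis using that by blast
qed

text \<open>The positivity sets of bounded bumps are relatively open in the half-space, so countably
  many of them have the same union, which contains \<open>A\<close>; their bumps are then
  summed.\<close>

lemma flow_bump_cover:
  fixes F :: "'a::euclidean_space \<Rightarrow> 'a"
  assumes "\<And>p. p \<in> A \<Longrightarrow> \<exists>\<beta> G. flow_bump F Xo \<beta> G \<and> bounded (\<beta> ` ({0..} \<times> UNIV)) \<and>
      bounded (G ` ({0..} \<times> UNIV)) \<and> \<beta> p > 0"
    and A: "A \<subseteq> {0..} \<times> UNIV"
  obtains \<beta> G where "flow_bump F Xo \<beta> G" "\<And>p. p \<in> A \<Longrightarrow> \<beta> p > 0"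
proof -
  let ?D = "{0..} \<times> UNIV :: (real \<times> 'a) set"
  define \<Phi> where "\<Phi> = {q. flow_bump F Xo (fst q) (snd q) \<and> bounded (fst q ` ?D) \<and> bounded (snd q ` ?D)}"
  define U where "U q = {p \<in> ?D. fst q p > 0}" for q :: "(real \<times> 'a \<Rightarrow> real) \<times> (real \<times> 'a \<Rightarrow> real \<times> 'a)"
  have "openin (top_of_set ?D) S" if S: "S \<in> U ` \<Phi>" for S
  proof -
    obtain q where q: "q \<in> \<Phi>" "S = U q" using S by blast
    have "(fst q has_derivative (\<lambda>h. snd q p \<bullet> h)) (at p within ?D)" if "p \<in> ?D" for p
      using q(1) that unfolding \<Phi>_def flow_bump_def by blast
    then have "continuous_on ?D (fst q)" by (rule has_derivative_continuous_on)
    moreover have "S = ?D \<inter> fst q -` {0<..}" by (auto simp: q U_def)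
    ultimately show ?thesis using continuous_openin_preimage_gen open_greaterThan by blast
  qed
  then obtain \<C> where \<C>: "\<C> \<subseteq> U ` \<Phi>" "countable \<C>" "\<Union>\<C> = \<Union>(U ` \<Phi>)"
    by (rule Lindelof_openin)
  have zero: "(\<lambda>_. 0, \<lambda>_. 0) \<in> \<Phi>"
    by (auto simp: \<Phi>_def flow_bump_def bounded_iff fun_eq_iff
        intro!: has_derivative_eq_rhs[OF has_derivative_const])
  \<comment> \<open>The positivity set of the zero bump is empty. Adding it makes the countable
    family nonempty, so that it can be enumerated by the natural numbers.\<close>
  define \<C>\<^sub>0 where "\<C>\<^sub>0 = insert (U (\<lambda>_. 0, \<lambda>_. 0)) \<C>"
  have ran: "range (from_nat_into \<C>\<^sub>0) = \<C>\<^sub>0"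
    using \<C>(2) by (intro range_from_nat_into) (auto simp: \<C>\<^sub>0_def)
  have "\<exists>q. q \<in> \<Phi> \<and> U q = from_nat_into \<C>\<^sub>0 n" for n
  proof -
    have "from_nat_into \<C>\<^sub>0 n \<in> \<C>\<^sub>0" using ran by blast
    also have "\<C>\<^sub>0 \<subseteq> U ` \<Phi>" using \<C>(1) zero by (auto simp: \<C>\<^sub>0_def)
    finally show ?thesis by force
  qed
  then obtain q where q: "\<And>n. q n \<in> \<Phi>" "\<And>n. U (q n) = from_nat_into \<C>\<^sub>0 n" by metis
  obtain \<beta> G where bump: "flow_bump F Xo \<beta> G" 
    and pos: "\<And>n p. p \<in> ?D \<Longrightarrow> fst (q n) p > 0 \<Longrightarrow> \<beta> p > 0"
    using flow_bump_suminf[of F Xo "\<lambda>n. fst (q n)" "\<lambda>n. snd (q n)"] q(1) unfolding \<Phi>_def by blast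
  moreover have "\<beta> p > 0" if p: "p \<in> A" for p
  proof -
    obtain \<beta>' G' where "(\<beta>', G') \<in> \<Phi>" "\<beta>' p > 0"
      using assms(1)[OF p] by (auto simp: \<Phi>_def)
    then have "p \<in> \<Union>(U ` \<Phi>)" using p A by (force simp: U_def)
    then have "p \<in> \<Union>\<C>\<^sub>0" using \<C>(3) by (auto simp: \<C>\<^sub>0_def)
    then obtain n where "p \<in> U (q n)" using ran q(2) by (metis UnionE imageE)
    then show ?thesis using pos by (auto simp: U_def)
  qed
  ultimately show thesis using that by blast
qed


section \<open>Equivalence of safety and the existence of a barrier\<close>

theorem theorem4:
  fixes F :: "real^'n \<Rightarrow> real^'n"
    and F' :: "real^'n \<Rightarrow> ((real^'n) \<Rightarrow>\<^sub>L (real^'n))"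
    and Xo Xu :: "(real^'n) set"
  assumes F_deriv: "\<And>x. (F has_derivative blinfun_apply (F' x)) (at x)"
    and F'_cont: "continuous_on UNIV F'"
    and bc: "backward_complete F"
    and Xo_closed: "closed Xo"
    and disj: "Xo \<inter> Xu = {}"
  shows "safe F Xo Xu \<longleftrightarrow>
    (\<exists>B :: real \<Rightarrow> real^'n \<Rightarrow> real.
       barrier_candidate Xo Xu B
       \<and> continuous_on ({0..} \<times> UNIV) (\<lambda>(t, x). B t x)
       \<and> (let S = ({0..} \<times> UNIV) - {(t, x). t \<ge> 0 \<and> B t x \<le> 0} in
          (\<exists>DB :: real \<times> (real^'n) \<Rightarrow> ((real \<times> (real^'n)) \<Rightarrow>\<^sub>L real).
             (\<forall>p\<in>S. ((\<lambda>(t, x). B t x) has_derivative blinfun_apply (DB p)) (at p within S))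
             \<and> continuous_on S DB
             \<and> (\<forall>(t, x)\<in>S. blinfun_apply (DB (t, x)) (1, F x) \<le> 0))))"
    (is "_ \<longleftrightarrow> (\<exists>B. ?barrier B)")
proof
  let ?D = "{0..} \<times> UNIV :: (real \<times> (real^'n)) set"
  assume safe: "safe F Xo Xu"
  have "\<exists>\<beta> G. flow_bump F Xo \<beta> G \<and> bounded (\<beta> ` ?D) \<and> bounded (G ` ?D) \<and> \<beta> p > 0"
    if "p \<in> {0..} \<times> Xu" for p
    using that safe_imp_flow_bump[OF F_deriv F'_cont bc Xo_closed safe, of "snd p" "fst p"]
    by (metis atLeast_iff mem_Times_iff prod.collapse)
  then obtain \<beta> G where bump: "flow_bump F Xo \<beta> G" and pos: "\<And>p. p \<in> {0..} \<times> Xu \<Longrightarrow> \<beta> p > 0"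
    using flow_bump_cover[of "{0..} \<times> Xu" F Xo] by blast
  have D\<beta>: "(\<beta> has_derivative (\<lambda>h. G p \<bullet> h)) (at p within ?D)" if "p \<in> ?D" for p
    using bump that unfolding flow_bump_def by blast
  have G: "continuous_on ?D G" "\<And>t x. t \<ge> 0 \<Longrightarrow> G (t, x) \<bullet> (1, F x) \<le> 0"
    using bump unfolding flow_bump_def by blast+
  \<comment> \<open>Since \<open>\<beta>\<close> is nonnegative, the set where \<open>B\<close> is
    at most 0 is its zero set, which contains \<open>{0..} \<times> Xo\<close>.\<close>
  define B where "B t x = \<beta> (t, x)" for t x
  have B: "(\<lambda>(t, x). B t x) = \<beta>" by (auto simp: B_def)
  define S where "S = ?D - {(t, x). t \<ge> 0 \<and> B t x \<le> 0}"
  have "S \<subseteq> ?D" by (auto simp: S_def)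
  have "barrier_candidate Xo Xu B"
    using bump pos by (auto simp: barrier_candidate_def B_def flow_bump_def)
  moreover have "continuous_on ?D (\<lambda>(t, x). B t x)"
    unfolding B using D\<beta> by (rule has_derivative_continuous_on)
  \<comment> \<open>The gradient becomes a functional through \<open>blinfun_inner_right\<close>, a
    bounded linear map, so continuity of \<open>G\<close> carries over.\<close>
  moreover have "((\<lambda>(t, x). B t x) has_derivative blinfun_apply (blinfun_inner_right (G p))) (at p within S)"
    if "p \<in> S" for p
    unfolding B blinfun_inner_right.rep_eq
    using that \<open>S \<subseteq> ?D\<close> by (intro has_derivative_subset[OF D\<beta>]) auto
  moreover have "continuous_on S (\<lambda>p. blinfun_inner_right (G p))"
    by (intro bounded_linear.continuous_on[OF bounded_linear_blinfun_inner_right]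
        continuous_on_subset[OF G(1) \<open>S \<subseteq> ?D\<close>])
  moreover have "blinfun_apply (blinfun_inner_right (G (t, x))) (1, F x) \<le> 0" if "(t, x) \<in> S" for t x
    using G(2)[of t x] that \<open>S \<subseteq> ?D\<close> by auto
  ultimately have "?barrier B"
    unfolding Let_def S_def[symmetric]
    by (intro conjI exI[of _ "\<lambda>p. blinfun_inner_right (G p)"]) auto
  then show "\<exists>B. ?barrier B" by (rule exI[of ?barrier])
next
  have contF: "continuous_on UNIV F"
    using F_deriv by (intro has_derivative_continuous_on) (auto intro: has_derivative_at_withinI)
  assume "\<exists>B. ?barrier B"
  then obtain B S and DB :: "real \<times> (real^'n) \<Rightarrow> ((real \<times> (real^'n)) \<Rightarrow>\<^sub>L real)"
    where "barrier_candidate Xo Xu B" "continuous_on ({0..} \<times> UNIV) (\<lambda>(t, x). B t x)"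
      "S = ({0..} \<times> UNIV) - {(t, x). t \<ge> 0 \<and> B t x \<le> 0}"
      "\<forall>p\<in>S. ((\<lambda>(t, x). B t x) has_derivative blinfun_apply (DB p)) (at p within S)"
      "\<forall>(t, x)\<in>S. blinfun_apply (DB (t, x)) (1, F x) \<le> 0"
    unfolding Let_def by blast
  then show "safe F Xo Xu"
    by (intro safe_if_barrier[OF contF, of Xo Xu B S DB]) auto
qed

end
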